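(* Let $n\geq 2$. Then $H^2(G(n),\mathbb{T})\cong\mathbb{T}^{\frac{1}{3}(n+1)n(n-1)}$. Moreover, under such an isomorphism, for each set of $\frac{1}{3}(n+1)n(n-1)$ parameters $$\{\lambda_{i,jk} : 1\leq i\leq k,\ 1\leq j<k\leq n\}\subseteq\mathbb{T},$$ the associated class $[\sigma]$ in $H^2(G(n),\mathbb{T})$ may be represented by the two-cocycle $$\sigma(r,s)=\prod_{1\leq i<j<k\leq n}\lambda_{i,jk}^{s_{jk}r_i+s_kr_{ij}}\,\lambda_{j,ik}^{s_{ik}r_j+s_k(r_ir_j-r_{ij})}\cdot\prod_{1\leq j<k\leq n}\lambda_{j,jk}^{s_{jk}r_j+\frac{1}{2}s_kr_j(r_j-1)}\,\lambda_{k,jk}^{r_k(s_{jk}+r_js_k)+\frac{1}{2}r_js_k(s_k-1)}$$ for $r,s\in G(n)$.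
   Context: $G(n)$ is the free nilpotent group of class $2$ and rank $n$, realized as the set of integer tuples $r=(r_1,\dotsc,r_n,(r_{jk})_{1\leq j<k\leq n})$ with multiplication $(rs)_i=r_i+s_i$ and $(rs)_{jk}=r_{jk}+s_{jk}+r_js_k$. A two-cocycle of a discrete group $G$ (with identity $e$) is a function $\sigma\colon G\times G\to\mathbb{T}$ with $\sigma(r,s)\sigma(rs,t)=\sigma(r,st)\sigma(s,t)$ and $\sigma(r,e)=\sigma(e,r)=1$ for all $r,s,t\in G$. Two two-cocycles $\sigma,\tau$ are similar, $\sigma\sim\tau$, if there is a function $\beta\colon G\to\mathbb{T}$ with $\tau(r,s)=\beta(r)\beta(s)\overline{\beta(rs)}\sigma(r,s)$ for all $r,s\in G$. $H^2(G,\mathbb{T})$ is the abelian group of similarity classes of two-cocycles under pointwise multiplication. *)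

theory Defs
  imports "HOL-Algebra.Product_Groups" Complex_Main
begin

section \<open>The free nilpotent group of class two and rank n\<close>

definition index_pairs :: "nat \<Rightarrow> (nat \<times> nat) set" where
  "index_pairs n = {(j, k). 1 \<le> j \<and> j < k \<and> k \<le> n}"

text \<open>
  A tuple is a pair consisting of the coordinates \<open>r\<^sub>i\<close> for \<open>1 \<le> i \<le> n\<close>
  and the coordinates \<open>r\<^sub>j\<^sub>k\<close> for \<open>1 \<le> j < k \<le> n\<close>; both components are extensional
  (equal to \<^const>\<open>undefined\<close> at all other arguments), so that equality of tuples is
  equality of coordinates.
\<close>

type_synonym tup = "(nat \<Rightarrow> int) \<times> (nat \<times> nat \<Rightarrow> int)"

definition free_nil2 :: "nat \<Rightarrow> tup monoid" where
  "free_nil2 n =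
     \<lparr>carrier = ({1..n} \<rightarrow>\<^sub>E UNIV) \<times> (index_pairs n \<rightarrow>\<^sub>E UNIV),
      mult = (\<lambda>r s.
        (\<lambda>i\<in>{1..n}. fst r i + fst s i,
         \<lambda>(j, k)\<in>index_pairs n. snd r (j, k) + snd s (j, k) + fst r j * fst s k)),
      one = (\<lambda>i\<in>{1..n}. 0, \<lambda>p\<in>index_pairs n. 0)\<rparr>"


section \<open>Second cohomology with circle coefficients\<close>

definition circle_group :: "complex monoid" where
  "circle_group = \<lparr>carrier = {z. norm z = 1}, mult = (*), one = 1\<rparr>"

abbreviation circle :: "complex set" where
  "circle \<equiv> carrier circle_group"

abbreviation torus_group :: "'i set \<Rightarrow> ('i \<Rightarrow> complex) monoid" where
  "torus_group I \<equiv> product_group I (\<lambda>_. circle_group)"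

text \<open>Cocycles are extensional functions on \<open>carrier G \<times> carrier G\<close>.\<close>

definition two_cocycles :: "('a, 'b) monoid_scheme \<Rightarrow> ('a \<times> 'a \<Rightarrow> complex) set" where
  "two_cocycles G =
     {\<sigma> \<in> carrier G \<times> carrier G \<rightarrow>\<^sub>E circle.
        (\<forall>r\<in>carrier G. \<forall>s\<in>carrier G. \<forall>t\<in>carrier G.
           \<sigma> (r, s) * \<sigma> (r \<otimes>\<^bsub>G\<^esub> s, t) = \<sigma> (r, s \<otimes>\<^bsub>G\<^esub> t) * \<sigma> (s, t)) \<and>
        (\<forall>r\<in>carrier G. \<sigma> (r, \<one>\<^bsub>G\<^esub>) = 1 \<and> \<sigma> (\<one>\<^bsub>G\<^esub>, r) = 1)}"

definition similarity ::
    "('a, 'b) monoid_scheme \<Rightarrow> (('a \<times> 'a \<Rightarrow> complex) \<times> ('a \<times> 'a \<Rightarrow> complex)) set" where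
  "similarity G =
     {(\<sigma>, \<tau>). \<sigma> \<in> two_cocycles G \<and> \<tau> \<in> two_cocycles G \<and>
        (\<exists>\<beta>\<in>carrier G \<rightarrow> circle. \<forall>r\<in>carrier G. \<forall>s\<in>carrier G.
           \<tau> (r, s) = \<beta> r * \<beta> s * cnj (\<beta> (r \<otimes>\<^bsub>G\<^esub> s)) * \<sigma> (r, s))}"

definition similarity_class ::
    "('a, 'b) monoid_scheme \<Rightarrow> ('a \<times> 'a \<Rightarrow> complex) \<Rightarrow> ('a \<times> 'a \<Rightarrow> complex) set" where
  "similarity_class G \<sigma> = similarity G `` {\<sigma>}"

definition cocycle_mult ::
    "('a, 'b) monoid_scheme \<Rightarrow> ('a \<times> 'a \<Rightarrow> complex) \<Rightarrow> ('a \<times> 'a \<Rightarrow> complex) \<Rightarrow>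
      ('a \<times> 'a \<Rightarrow> complex)" where
  "cocycle_mult G \<sigma> \<tau> = (\<lambda>p\<in>carrier G \<times> carrier G. \<sigma> p * \<tau> p)"

definition H2 :: "('a, 'b) monoid_scheme \<Rightarrow> ('a \<times> 'a \<Rightarrow> complex) set monoid" where
  "H2 G =
     \<lparr>carrier = two_cocycles G // similarity G,
      mult = (\<lambda>X Y. \<Union>\<sigma>\<in>X. \<Union>\<tau>\<in>Y. similarity_class G (cocycle_mult G \<sigma> \<tau>)),
      one = similarity_class G (\<lambda>p\<in>carrier G \<times> carrier G. 1)\<rparr>"


section \<open>The parametrised cocycles\<close>

text \<open>The parameter \<open>\<lambda>\<^sub>i\<^sub>,\<^sub>j\<^sub>k\<close> is \<open>lam (i, j, k)\<close>.\<close>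

definition param_index :: "nat \<Rightarrow> (nat \<times> nat \<times> nat) set" where
  "param_index n = {(i, j, k). 1 \<le> i \<and> i \<le> k \<and> 1 \<le> j \<and> j < k \<and> k \<le> n}"

text \<open>Both divisions by two below are exact.\<close>

definition param_cocycle :: "nat \<Rightarrow> (nat \<times> nat \<times> nat \<Rightarrow> complex) \<Rightarrow> tup \<times> tup \<Rightarrow> complex" where
  "param_cocycle n lam =
     (\<lambda>((r1, r2), (s1, s2)) \<in> carrier (free_nil2 n) \<times> carrier (free_nil2 n).
        (\<Prod>(i, j, k) \<in> {(i, j, k). 1 \<le> i \<and> i < j \<and> j < k \<and> k \<le> n}.
            lam (i, j, k) powi (s2 (j, k) * r1 i + s1 k * r2 (i, j)) *
            lam (j, i, k) powi (s2 (i, k) * r1 j + s1 k * (r1 i * r1 j - r2 (i, j)))) *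
        (\<Prod>(j, k) \<in> {(j, k). 1 \<le> j \<and> j < k \<and> k \<le> n}.
            lam (j, j, k) powi (s2 (j, k) * r1 j + (s1 k * r1 j * (r1 j - 1)) div 2) *
            lam (k, j, k) powi
              (r1 k * (s2 (j, k) + r1 j * s1 k) + (r1 j * s1 k * (s1 k - 1)) div 2)))"


section \<open>Well-definedness\<close>

lemma group_free_nil2: "group (free_nil2 n)"
proof (rule groupI)
  fix x assume x: "x \<in> carrier (free_nil2 n)"
  let ?y = "(\<lambda>i\<in>{1..n}. - fst x i, \<lambda>(j, k)\<in>index_pairs n. - snd x (j, k) + fst x j * fst x k)"
  show "\<exists>y\<in>carrier (free_nil2 n). y \<otimes>\<^bsub>free_nil2 n\<^esub> x = \<one>\<^bsub>free_nil2 n\<^esub>"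
    by (rule bexI[of _ ?y])
       (use x in \<open>auto simp: free_nil2_def index_pairs_def fun_eq_iff restrict_def\<close>)
next
  fix x y z
  assume "x \<in> carrier (free_nil2 n)" "y \<in> carrier (free_nil2 n)" "z \<in> carrier (free_nil2 n)"
  show "x \<otimes>\<^bsub>free_nil2 n\<^esub> y \<otimes>\<^bsub>free_nil2 n\<^esub> z = x \<otimes>\<^bsub>free_nil2 n\<^esub> (y \<otimes>\<^bsub>free_nil2 n\<^esub> z)"
    by (auto simp: free_nil2_def index_pairs_def fun_eq_iff restrict_def algebra_simps)
next
  fix x assume "x \<in> carrier (free_nil2 n)"
  then have "fst x \<in> extensional {1..n}" "snd x \<in> extensional (index_pairs n)"
    by (auto simp: free_nil2_def PiE_def)
  then show "\<one>\<^bsub>free_nil2 n\<^esub> \<otimes>\<^bsub>free_nil2 n\<^esub> x = x"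
    by (intro prod_eqI)
       (auto simp: free_nil2_def index_pairs_def fun_eq_iff restrict_def extensional_def)
next
  show "\<one>\<^bsub>free_nil2 n\<^esub> \<in> carrier (free_nil2 n)"
    by (simp add: free_nil2_def restrict_PiE_iff)
next
  fix x y
  show "x \<otimes>\<^bsub>free_nil2 n\<^esub> y \<in> carrier (free_nil2 n)"
    by (simp add: free_nil2_def restrict_PiE_iff)
qed

lemma circle_group_simps [simp]:
  "z \<in> circle \<longleftrightarrow> norm z = 1" "x \<otimes>\<^bsub>circle_group\<^esub> y = x * y" "\<one>\<^bsub>circle_group\<^esub> = 1"
  by (simp_all add: circle_group_def)

lemma norm_one_mult_cnj: "norm z = 1 \<Longrightarrow> z * cnj z = 1"
  by (simp add: complex_norm_square[symmetric])

lemma comm_group_circle_group: "comm_group circle_group"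
proof (rule comm_groupI)
  fix z assume "z \<in> circle"
  then show "\<exists>w\<in>circle. w \<otimes>\<^bsub>circle_group\<^esub> z = \<one>\<^bsub>circle_group\<^esub>"
    by (intro bexI[of _ "cnj z"]) (auto simp: norm_one_mult_cnj mult.commute)
qed (auto simp: norm_mult)

lemma two_cocycles_norm:
  "\<lbrakk>\<sigma> \<in> two_cocycles G; r \<in> carrier G; s \<in> carrier G\<rbrakk> \<Longrightarrow> norm (\<sigma> (r, s)) = 1"
  by (auto simp: two_cocycles_def PiE_def Pi_def)

lemma two_cocycles_eqI:
  "\<lbrakk>\<sigma> \<in> two_cocycles G; \<tau> \<in> two_cocycles G;
    \<And>r s. \<lbrakk>r \<in> carrier G; s \<in> carrier G\<rbrakk> \<Longrightarrow> \<sigma> (r, s) = \<tau> (r, s)\<rbrakk> \<Longrightarrow> \<sigma> = \<tau>"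
  by (rule extensionalityI[of _ "carrier G \<times> carrier G"])
     (auto simp: two_cocycles_def PiE_def)

lemma equiv_similarity:
  assumes "group G"
  shows "equiv (two_cocycles G) (similarity G)"
proof -
  interpret group G by fact
  show ?thesis
  proof (rule equivI)
    show "similarity G \<subseteq> two_cocycles G \<times> two_cocycles G"
      by (auto simp: similarity_def)
    show "refl_on (two_cocycles G) (similarity G)"
      by (rule refl_onI) (auto simp: similarity_def intro!: bexI[of _ "\<lambda>_. 1"])
    show "sym (similarity G)"
    proof (rule symI)
      fix \<sigma> \<tau> assume "(\<sigma>, \<tau>) \<in> similarity G"
      then obtain \<beta> where b: "\<sigma> \<in> two_cocycles G" "\<tau> \<in> two_cocycles G" "\<beta> \<in> carrier G \<rightarrow> circle"
        "\<And>r s. \<lbrakk>r \<in> carrier G; s \<in> carrier G\<rbrakk> \<Longrightarrow>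
           \<tau> (r, s) = \<beta> r * \<beta> s * cnj (\<beta> (r \<otimes>\<^bsub>G\<^esub> s)) * \<sigma> (r, s)"
        by (auto simp: similarity_def)
      have "\<sigma> (r, s) = cnj (\<beta> r) * cnj (\<beta> s) * cnj (cnj (\<beta> (r \<otimes>\<^bsub>G\<^esub> s))) * \<tau> (r, s)"
        if "r \<in> carrier G" "s \<in> carrier G" for r s
      proof -
        have "norm (\<beta> r) = 1" "norm (\<beta> s) = 1" "norm (\<beta> (r \<otimes>\<^bsub>G\<^esub> s)) = 1"
          using b(3) that by auto
        from this[THEN norm_one_mult_cnj] have
          "(\<beta> r * cnj (\<beta> r)) * (\<beta> s * cnj (\<beta> s)) *
             (\<beta> (r \<otimes>\<^bsub>G\<^esub> s) * cnj (\<beta> (r \<otimes>\<^bsub>G\<^esub> s))) * \<sigma> (r, s) = \<sigma> (r, s)"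
          by simp
        then show ?thesis using b(4)[OF that] by (simp add: mult_ac)
      qed
      then show "(\<tau>, \<sigma>) \<in> similarity G"
        using b(1-3) unfolding similarity_def
        by (auto intro!: bexI[of _ "\<lambda>r. cnj (\<beta> r)"])
    qed
    show "trans (similarity G)"
    proof (rule transI)
      fix \<sigma> \<tau> \<rho> assume "(\<sigma>, \<tau>) \<in> similarity G" "(\<tau>, \<rho>) \<in> similarity G"
      then obtain \<beta> \<gamma> where b: "\<sigma> \<in> two_cocycles G" "\<rho> \<in> two_cocycles G"
        "\<beta> \<in> carrier G \<rightarrow> circle" "\<gamma> \<in> carrier G \<rightarrow> circle"
        "\<And>r s. \<lbrakk>r \<in> carrier G; s \<in> carrier G\<rbrakk> \<Longrightarrow>
           \<tau> (r, s) = \<beta> r * \<beta> s * cnj (\<beta> (r \<otimes>\<^bsub>G\<^esub> s)) * \<sigma> (r, s)"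
        "\<And>r s. \<lbrakk>r \<in> carrier G; s \<in> carrier G\<rbrakk> \<Longrightarrow>
           \<rho> (r, s) = \<gamma> r * \<gamma> s * cnj (\<gamma> (r \<otimes>\<^bsub>G\<^esub> s)) * \<tau> (r, s)"
        by (auto simp: similarity_def)
      then show "(\<sigma>, \<rho>) \<in> similarity G"
        unfolding similarity_def
        by (auto intro!: bexI[of _ "\<lambda>r. \<beta> r * \<gamma> r"] simp: norm_mult Pi_iff mult_ac)
    qed
  qed
qed

lemma one_two_cocycle:
  assumes "group G"
  shows "(\<lambda>p\<in>carrier G \<times> carrier G. 1) \<in> two_cocycles G"
proof -
  interpret group G by fact
  show ?thesis by (auto simp: two_cocycles_def)
qed

lemma cocycle_mult_closed:
  assumes "group G" "\<sigma> \<in> two_cocycles G" "\<tau> \<in> two_cocycles G"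
  shows "cocycle_mult G \<sigma> \<tau> \<in> two_cocycles G"
proof -
  interpret group G by fact
  have "(\<sigma> (r, s) * \<tau> (r, s)) * (\<sigma> (r \<otimes>\<^bsub>G\<^esub> s, t) * \<tau> (r \<otimes>\<^bsub>G\<^esub> s, t)) =
        (\<sigma> (r, s \<otimes>\<^bsub>G\<^esub> t) * \<tau> (r, s \<otimes>\<^bsub>G\<^esub> t)) * (\<sigma> (s, t) * \<tau> (s, t))"
    if "r \<in> carrier G" "s \<in> carrier G" "t \<in> carrier G" for r s t
  proof -
    have "(\<sigma> (r, s) * \<sigma> (r \<otimes>\<^bsub>G\<^esub> s, t)) * (\<tau> (r, s) * \<tau> (r \<otimes>\<^bsub>G\<^esub> s, t)) =
          (\<sigma> (r, s \<otimes>\<^bsub>G\<^esub> t) * \<sigma> (s, t)) * (\<tau> (r, s \<otimes>\<^bsub>G\<^esub> t) * \<tau> (s, t))"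
      using assms that by (auto simp: two_cocycles_def)
    then show ?thesis by (simp only: mult_ac)
  qed
  moreover have "norm (\<sigma> (r, s) * \<tau> (r, s)) = 1"
    if "r \<in> carrier G" "s \<in> carrier G" for r s
    using two_cocycles_norm[OF assms(2) that] two_cocycles_norm[OF assms(3) that]
    by (simp add: norm_mult)
  moreover have "\<sigma> (r, \<one>\<^bsub>G\<^esub>) = 1" "\<sigma> (\<one>\<^bsub>G\<^esub>, r) = 1" "\<tau> (r, \<one>\<^bsub>G\<^esub>) = 1" "\<tau> (\<one>\<^bsub>G\<^esub>, r) = 1"
    if "r \<in> carrier G" for r
    using assms that by (auto simp: two_cocycles_def)
  ultimately show ?thesis
    by (auto simp: two_cocycles_def cocycle_mult_def)
qed

lemma cocycle_mult_similar:
  assumes "group G" "(\<sigma>, \<sigma>') \<in> similarity G" "(\<tau>, \<tau>') \<in> similarity G"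
  shows "(cocycle_mult G \<sigma> \<tau>, cocycle_mult G \<sigma>' \<tau>') \<in> similarity G"
proof -
  interpret group G by fact
  obtain \<beta> \<gamma> where b: "\<sigma> \<in> two_cocycles G" "\<sigma>' \<in> two_cocycles G"
    "\<tau> \<in> two_cocycles G" "\<tau>' \<in> two_cocycles G"
    "\<beta> \<in> carrier G \<rightarrow> circle" "\<gamma> \<in> carrier G \<rightarrow> circle"
    "\<And>r s. \<lbrakk>r \<in> carrier G; s \<in> carrier G\<rbrakk> \<Longrightarrow>
       \<sigma>' (r, s) = \<beta> r * \<beta> s * cnj (\<beta> (r \<otimes>\<^bsub>G\<^esub> s)) * \<sigma> (r, s)"
    "\<And>r s. \<lbrakk>r \<in> carrier G; s \<in> carrier G\<rbrakk> \<Longrightarrow>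
       \<tau>' (r, s) = \<gamma> r * \<gamma> s * cnj (\<gamma> (r \<otimes>\<^bsub>G\<^esub> s)) * \<tau> (r, s)"
    using assms(2,3) by (auto simp: similarity_def)
  have "(\<lambda>r. \<beta> r * \<gamma> r) \<in> carrier G \<rightarrow> circle"
    using b(5,6) by (auto simp: norm_mult Pi_iff)
  moreover have "cocycle_mult G \<sigma>' \<tau>' (r, s) =
      (\<beta> r * \<gamma> r) * (\<beta> s * \<gamma> s) * cnj (\<beta> (r \<otimes>\<^bsub>G\<^esub> s) * \<gamma> (r \<otimes>\<^bsub>G\<^esub> s)) * cocycle_mult G \<sigma> \<tau> (r, s)"
    if "r \<in> carrier G" "s \<in> carrier G" for r s
    using b(7,8)[OF that] that by (simp add: cocycle_mult_def mult_ac)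
  ultimately have "\<exists>\<beta>\<in>carrier G \<rightarrow> circle. \<forall>r\<in>carrier G. \<forall>s\<in>carrier G.
      cocycle_mult G \<sigma>' \<tau>' (r, s) =
        \<beta> r * \<beta> s * cnj (\<beta> (r \<otimes>\<^bsub>G\<^esub> s)) * cocycle_mult G \<sigma> \<tau> (r, s)"
    by (intro bexI[of _ "\<lambda>r. \<beta> r * \<gamma> r"]) simp_all
  then show ?thesis
    using cocycle_mult_closed[OF assms(1) b(1) b(3)] cocycle_mult_closed[OF assms(1) b(2) b(4)]
    by (simp only: similarity_def mem_Collect_eq prod.case simp_thms)
qed

lemma H2_mult_class:
  assumes "group G" "\<sigma> \<in> two_cocycles G" "\<tau> \<in> two_cocycles G"
  shows "similarity_class G \<sigma> \<otimes>\<^bsub>H2 G\<^esub> similarity_class G \<tau> =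
    similarity_class G (cocycle_mult G \<sigma> \<tau>)"
proof -
  note eq = equiv_similarity[OF assms(1)]
  have 1: "similarity_class G (cocycle_mult G \<sigma>' \<tau>') = similarity_class G (cocycle_mult G \<sigma> \<tau>)"
    if "\<sigma>' \<in> similarity_class G \<sigma>" "\<tau>' \<in> similarity_class G \<tau>" for \<sigma>' \<tau>'
    using equiv_class_eq[OF eq cocycle_mult_similar[OF assms(1), of \<sigma> \<sigma>' \<tau> \<tau>']] that
    by (simp add: similarity_class_def)
  have 2: "\<sigma> \<in> similarity_class G \<sigma>" "\<tau> \<in> similarity_class G \<tau>"
    using equiv_class_self[OF eq] assms(2,3) by (auto simp: similarity_class_def)
  have "(\<Union>\<sigma>'\<in>similarity_class G \<sigma>. \<Union>\<tau>'\<in>similarity_class G \<tau>.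
          similarity_class G (cocycle_mult G \<sigma>' \<tau>')) =
        (\<Union>\<sigma>'\<in>similarity_class G \<sigma>. \<Union>\<tau>'\<in>similarity_class G \<tau>.
          similarity_class G (cocycle_mult G \<sigma> \<tau>))"
    by (intro SUP_cong refl 1)
  also have "\<dots> = similarity_class G (cocycle_mult G \<sigma> \<tau>)"
    using 2 by blast
  finally show ?thesis by (simp add: H2_def)
qed

lemma H2_carrier: "carrier (H2 G) = similarity_class G ` two_cocycles G"
  by (auto simp: H2_def similarity_class_def quotient_def)

lemma comm_group_H2:
  assumes "group G"
  shows "comm_group (H2 G)"
proof -
  note mc = H2_mult_class[OF assms] and cl = cocycle_mult_closed[OF assms]
  have one: "\<one>\<^bsub>H2 G\<^esub> = similarity_class G (\<lambda>p\<in>carrier G \<times> carrier G. 1)"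
    by (simp add: H2_def)
  have assoc: "cocycle_mult G (cocycle_mult G a b) c = cocycle_mult G a (cocycle_mult G b c)" for a b c
    by (auto simp: cocycle_mult_def mult_ac)
  have comm: "cocycle_mult G a b = cocycle_mult G b a" for a b
    by (auto simp: cocycle_mult_def mult_ac)
  have unit: "cocycle_mult G (\<lambda>p\<in>carrier G \<times> carrier G. 1) a = a" if "a \<in> two_cocycles G" for a
    by (rule two_cocycles_eqI[OF cl[OF one_two_cocycle[OF assms] that] that])
       (simp add: cocycle_mult_def)
  show ?thesis
  proof (rule comm_groupI)
    fix x y assume "x \<in> carrier (H2 G)" "y \<in> carrier (H2 G)"
    then obtain a b where "a \<in> two_cocycles G" "b \<in> two_cocycles G"
      "x = similarity_class G a" "y = similarity_class G b"
      unfolding H2_carrier by blast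
    then show "x \<otimes>\<^bsub>H2 G\<^esub> y = y \<otimes>\<^bsub>H2 G\<^esub> x"
      by (simp add: mc comm[of a b])
  next
    fix x assume "x \<in> carrier (H2 G)"
    then obtain a where a: "a \<in> two_cocycles G" "x = similarity_class G a"
      by (auto simp: H2_carrier)
    interpret group G by fact
    let ?b = "\<lambda>p\<in>carrier G \<times> carrier G. cnj (a p)"
    have "cnj (a (r, s)) * cnj (a (r \<otimes>\<^bsub>G\<^esub> s, t)) = cnj (a (r, s \<otimes>\<^bsub>G\<^esub> t)) * cnj (a (s, t))"
      if "r \<in> carrier G" "s \<in> carrier G" "t \<in> carrier G" for r s t
      using a(1) that unfolding two_cocycles_def by (simp flip: complex_cnj_mult)
    then have b: "?b \<in> two_cocycles G"
      using a(1) by (auto simp: two_cocycles_def PiE_def Pi_def)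
    have "cocycle_mult G ?b a = (\<lambda>p\<in>carrier G \<times> carrier G. 1)"
      by (rule two_cocycles_eqI[OF cl[OF b a(1)] one_two_cocycle[OF assms]])
         (simp add: cocycle_mult_def norm_one_mult_cnj[OF two_cocycles_norm[OF a(1)]] mult.commute)
    then show "\<exists>y\<in>carrier (H2 G). y \<otimes>\<^bsub>H2 G\<^esub> x = \<one>\<^bsub>H2 G\<^esub>"
      using a b mc[OF b a(1)] one by (auto simp: H2_carrier)
  qed (auto simp: H2_carrier mc cl one assoc unit one_two_cocycle[OF assms])
qed

end

theory Submission
  imports Defs
begin

text \<open>
  Write \<open>u\<^sub>i\<close> for the generators of \<open>G(n)\<close> and \<open>v\<^sub>j\<^sub>k\<close> for the central basis elements. The numbers
  \<open>\<sigma>(u\<^sub>i, v\<^sub>j\<^sub>k) / \<sigma>(v\<^sub>j\<^sub>k, u\<^sub>i)\<close> for \<open>i \<le> k\<close> depend only on the class of \<open>\<sigma>\<close>, and on the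
  parametrised cocycle they return the parameters, which gives a surjective homomorphism
  onto the torus. For its injectivity consider the central extension of \<open>G(n)\<close> by the circle defined by
  \<open>\<sigma>\<close>: these numbers are the commutators of a lift of \<open>u\<^sub>i\<close> with the commutator of lifts of
  \<open>u\<^sub>j\<close> and \<open>u\<^sub>k\<close>. If they are trivial for \<open>i \<le> k\<close>, then by the Hall--Witt identity they are
  trivial for all \<open>i\<close>, so the lifts generate a subgroup of class two, and freeness of
  \<open>G(n)\<close> yields a section of the extension.
\<close>

section \<open>Homomorphisms from the free nilpotent group of class two\<close>

context group
begin

lemma commutes_left:
  assumes "x \<otimes> y = y \<otimes> x" "x \<in> carrier G" "y \<in> carrier G" "w \<in> carrier G"
  shows "x \<otimes> (y \<otimes> w) = y \<otimes> (x \<otimes> w)"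
  using assms by (simp flip: m_assoc)

lemma commutes_mult:
  assumes "c \<otimes> x = x \<otimes> c" "c \<otimes> y = y \<otimes> c"
    and "c \<in> carrier G" "x \<in> carrier G" "y \<in> carrier G"
  shows "c \<otimes> (x \<otimes> y) = x \<otimes> y \<otimes> c"
  using assms by (metis m_assoc)

lemma commutes_inv:
  assumes "c \<otimes> x = x \<otimes> c" "c \<in> carrier G" "x \<in> carrier G"
  shows "c \<otimes> inv x = inv x \<otimes> c"
  using assms by (metis inv_closed inv_solve_left inv_solve_right m_assoc m_closed)

lemma conjugate_int_pow:
  fixes a :: int
  assumes "g \<in> carrier G" "x \<in> carrier G"
  shows "(inv g \<otimes> x \<otimes> g) [^] a = inv g \<otimes> x [^] a \<otimes> g"
proof -
  have "(\<lambda>x. inv g \<otimes> x \<otimes> g) \<in> hom G G"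
  proof (rule homI)
    fix x y assume "x \<in> carrier G" "y \<in> carrier G"
    then show "inv g \<otimes> (x \<otimes> y) \<otimes> g = inv g \<otimes> x \<otimes> g \<otimes> (inv g \<otimes> y \<otimes> g)"
      using assms(1) by (simp add: m_assoc) (simp flip: m_assoc)
  qed (use assms(1) in simp)
  from hom_int_pow[OF this assms(2) is_group is_group] show ?thesis by simp
qed

text \<open>Conjugation by \<open>w\<close> sends \<open>x\<close> to \<open>x \<otimes> z\<close>.
  It is an endomorphism, so it sends \<open>x [^] a\<close> to the \<open>a\<close>-th power of
  \<open>x \<otimes> z\<close>, which splits because \<open>x\<close> and \<open>z\<close>
  commute.\<close>

lemma int_pow_commute_past:
  fixes a :: int
  assumes "x \<otimes> w = w \<otimes> x \<otimes> z" "z \<otimes> x = x \<otimes> z"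
    and cl: "x \<in> carrier G" "w \<in> carrier G" "z \<in> carrier G"
  shows "x [^] a \<otimes> w = w \<otimes> x [^] a \<otimes> z [^] a"
proof -
  have "inv w \<otimes> x \<otimes> w = x \<otimes> z"
    using assms by (simp add: m_assoc inv_solve_left')
  then have "inv w \<otimes> x [^] a \<otimes> w = x [^] a \<otimes> z [^] a"
    using conjugate_int_pow[of w x a] int_pow_mult_distrib[of x z a] assms by simp
  then show ?thesis
    using cl by (simp add: m_assoc inv_solve_left')
qed

lemma commutes_int_pow:
  fixes a :: int
  assumes "c \<otimes> x = x \<otimes> c" "c \<in> carrier G" "x \<in> carrier G"
  shows "c \<otimes> x [^] a = x [^] a \<otimes> c"
  using int_pow_commute_past[of x c \<one> a] assms by simp

text \<open>Bilinearity of the commutator: \<open>int_pow_commute_past\<close> is applied once to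
  raise \<open>y\<close> to the power \<open>b\<close>, with commutator \<open>inv z\<close>, and
  once to raise \<open>x\<close> to the power \<open>a\<close>, with commutator
  \<open>z [^] b\<close>.\<close>

lemma int_pow_commutator:
  fixes a b :: int
  assumes xy: "x \<otimes> y = y \<otimes> x \<otimes> z" and "z \<otimes> x = x \<otimes> z" "z \<otimes> y = y \<otimes> z"
    and cl: "x \<in> carrier G" "y \<in> carrier G" "z \<in> carrier G"
  shows "x [^] a \<otimes> y [^] b = y [^] b \<otimes> x [^] a \<otimes> z [^] (a * b)"
proof -
  have zi: "inv z \<otimes> y = y \<otimes> inv z"
    using assms commutes_inv[of y z] by simp
  have "y \<otimes> x = x \<otimes> y \<otimes> inv z"
    using xy cl by (simp add: m_assoc)
  from int_pow_commute_past[OF this zi, of b]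
  have "y [^] b \<otimes> x = x \<otimes> y [^] b \<otimes> inv (z [^] b)"
    using cl by (simp add: int_pow_inv)
  then have "y [^] b \<otimes> x \<otimes> z [^] b = x \<otimes> y [^] b"
    using cl by (simp add: m_assoc)
  then have "x \<otimes> y [^] b = y [^] b \<otimes> x \<otimes> z [^] b" ..
  from int_pow_commute_past[OF this, of a]
  show ?thesis
    using assms commutes_int_pow[of x z b] by (simp add: int_pow_pow mult.commute)
qed

text \<open>Move \<open>w\<close> to the left through both sides of \<open>x y = y x z\<close> and compare.\<close>

lemma Hall_Witt_central:
  assumes xy: "x \<otimes> y = y \<otimes> x \<otimes> z" and xw: "x \<otimes> w = w \<otimes> x \<otimes> p" and yw: "y \<otimes> w = w \<otimes> y \<otimes> q"
    and p: "p \<otimes> x = x \<otimes> p" "p \<otimes> y = y \<otimes> p" "p \<otimes> w = w \<otimes> p"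
    and q: "q \<otimes> x = x \<otimes> q" "q \<otimes> y = y \<otimes> q"
    and cl: "x \<in> carrier G" "y \<in> carrier G" "z \<in> carrier G" "w \<in> carrier G"
      "p \<in> carrier G" "q \<in> carrier G"
  shows "z \<otimes> w = w \<otimes> z"
proof -
  \<comment> \<open>\<open>z\<close> is a word in \<open>x\<close> and \<open>y\<close>, and
    \<open>q\<close> is a word in \<open>y\<close> and \<open>w\<close>. Whatever commutes with the
    letters commutes with the word, which gives \<open>pz\<close>, \<open>qz\<close> and
    \<open>pq\<close>.\<close>
  have z: "z = inv (y \<otimes> x) \<otimes> (x \<otimes> y)"
    using xy cl by (metis inv_solve_left m_closed)
  have q': "q = inv (w \<otimes> y) \<otimes> (y \<otimes> w)"
    using yw cl by (metis inv_solve_left m_closed)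
  have pz: "p \<otimes> z = z \<otimes> p"
    unfolding z using p cl by (intro commutes_mult commutes_inv) auto
  have qz: "q \<otimes> z = z \<otimes> q"
    unfolding z using q cl by (intro commutes_mult commutes_inv) auto
  have pq: "p \<otimes> q = q \<otimes> p"
    unfolding q' using p cl by (intro commutes_mult commutes_inv) auto
  \<comment> \<open>The tail \<open>u\<close> lets these rules act inside right-nested products.
    They carry \<open>w\<close> to the left and put \<open>y\<close> before
    \<open>x\<close>.\<close>
  have l: "u \<in> carrier G \<Longrightarrow> x \<otimes> (w \<otimes> u) = w \<otimes> (x \<otimes> (p \<otimes> u))"
    "u \<in> carrier G \<Longrightarrow> y \<otimes> (w \<otimes> u) = w \<otimes> (y \<otimes> (q \<otimes> u))"
    "u \<in> carrier G \<Longrightarrow> x \<otimes> (y \<otimes> u) = y \<otimes> (x \<otimes> (z \<otimes> u))"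
    "u \<in> carrier G \<Longrightarrow> p \<otimes> (y \<otimes> u) = y \<otimes> (p \<otimes> u)"
    "u \<in> carrier G \<Longrightarrow> q \<otimes> (x \<otimes> u) = x \<otimes> (q \<otimes> u)" for u
    using xw yw xy p q cl by (simp_all flip: m_assoc)
  have "y \<otimes> (x \<otimes> (z \<otimes> w)) = x \<otimes> (y \<otimes> w)"
    using xy cl by (simp flip: m_assoc)
  also have "\<dots> = w \<otimes> (x \<otimes> (y \<otimes> (p \<otimes> q)))"
    using yw cl by (simp add: m_assoc l)
  also have "\<dots> = w \<otimes> (y \<otimes> (x \<otimes> (z \<otimes> (p \<otimes> q))))"
    using cl by (simp add: l)
  also have "\<dots> = w \<otimes> (y \<otimes> (x \<otimes> (q \<otimes> (p \<otimes> z))))"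
    using cl pz qz pq by (metis (no_types, opaque_lifting) m_assoc m_closed)
  also have "\<dots> = y \<otimes> (x \<otimes> (w \<otimes> z))"
    using cl by (simp add: l)
  finally show ?thesis
    using cl by simp
qed

end

section \<open>Collecting words in a group of class two\<close>

text \<open>The relations of the free nilpotent group, imposed on elements of any group. The
  families are total, so no relation carries a range condition; in both instances below
  \<open>z (j, k)\<close> is the identity unless \<open>j < k\<close>.\<close>

locale class2_system = group H for H (structure) +
  fixes x :: "nat \<Rightarrow> 'a" and z :: "nat \<times> nat \<Rightarrow> 'a"
  assumes x_closed [simp]: "x i \<in> carrier H"
    and z_closed [simp]: "z p \<in> carrier H"
    and z_x: "z p \<otimes> x i = x i \<otimes> z p"
    and z_z: "z p \<otimes> z q = z q \<otimes> z p"
    and x_x: "j < k \<Longrightarrow> x j \<otimes> x k = x k \<otimes> x j \<otimes> z (j, k)"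
begin

text \<open>
  \<open>word n r\<close> is the product of the \<open>x\<^sub>k\<^bsup>r\<^sub>k\<^esup>\<close> for decreasing \<open>k\<close>, in which the central factors
  \<open>z\<^sub>j\<^sub>k\<^bsup>r\<^sub>j\<^sub>k\<^esup>\<close> for \<open>j < k\<close> directly follow \<open>x\<^sub>k\<close>.
\<close>

fun column :: "nat \<Rightarrow> nat \<Rightarrow> (nat \<times> nat \<Rightarrow> int) \<Rightarrow> 'a" where
  "column 0 k e = \<one>"
| "column (Suc j) k e = z (Suc j, k) [^] e (Suc j, k) \<otimes> column j k e"

fun word :: "nat \<Rightarrow> (nat \<Rightarrow> int) \<times> (nat \<times> nat \<Rightarrow> int) \<Rightarrow> 'a" where
  "word 0 r = \<one>"
| "word (Suc m) r = x (Suc m) [^] fst r (Suc m) \<otimes> column m (Suc m) (snd r) \<otimes> word m r"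

lemma column_closed [simp]: "column j k e \<in> carrier H"
  by (induction j) auto

lemma word_closed [simp]: "word m r \<in> carrier H"
  by (induction m) auto

lemma column_commutes:
  assumes c: "\<And>p. c \<otimes> z p = z p \<otimes> c" "c \<in> carrier H"
  shows "c \<otimes> column j k e = column j k e \<otimes> c"
proof (induction j)
  case (Suc j)
  have "c \<otimes> z (Suc j, k) [^] e (Suc j, k) = z (Suc j, k) [^] e (Suc j, k) \<otimes> c"
    using c by (intro commutes_int_pow) auto
  with Suc c show ?case by (simp add: commutes_mult)
qed (use c in simp)

lemma column_z: "column j k e \<otimes> z p = z p \<otimes> column j k e"
  using column_commutes[of "z p" j k e] z_z by simp

lemma column_x: "column j k e \<otimes> x i = x i \<otimes> column j k e"
  using column_commutes[of "x i" j k e] z_x by simp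

lemma word_commutes:
  assumes c: "\<And>p. c \<otimes> z p = z p \<otimes> c" "\<And>i. c \<otimes> x i = x i \<otimes> c" "c \<in> carrier H"
  shows "c \<otimes> word m r = word m r \<otimes> c"
proof (induction m)
  case (Suc m)
  have "c \<otimes> x (Suc m) [^] fst r (Suc m) = x (Suc m) [^] fst r (Suc m) \<otimes> c"
    using c by (intro commutes_int_pow) auto
  with Suc c column_commutes[of c] show ?case by (simp add: commutes_mult)
qed (use c in simp)

lemma column_word: "column j k e \<otimes> word m r = word m r \<otimes> column j k e"
  by (intro word_commutes column_z column_x) auto

lemma column_add:
  "column j k (\<lambda>p. e p + f p) = column j k e \<otimes> column j k f"
proof (induction j)
  case (Suc j)
  let ?z = "z (Suc j, k)"
  have "column j k e \<otimes> ?z [^] f (Suc j, k) = ?z [^] f (Suc j, k) \<otimes> column j k e"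
    by (intro commutes_int_pow column_z) auto
  then show ?case
    using Suc by (simp add: int_pow_mult m_assoc commutes_left)
qed simp

lemma column_cong:
  "(\<And>i. \<lbrakk>1 \<le> i; i \<le> j\<rbrakk> \<Longrightarrow> e (i, k) = f (i, k)) \<Longrightarrow> column j k e = column j k f"
  by (induction j) auto

lemma word_cong:
  assumes "\<And>i. \<lbrakk>1 \<le> i; i \<le> m\<rbrakk> \<Longrightarrow> fst r i = fst s i"
    and "\<And>j k. \<lbrakk>1 \<le> j; j < k; k \<le> m\<rbrakk> \<Longrightarrow> snd r (j, k) = snd s (j, k)"
  shows "word m r = word m s"
  using assms
proof (induction m)
  case (Suc m)
  have "column m (Suc m) (snd r) = column m (Suc m) (snd s)"
    using Suc.prems by (intro column_cong) auto
  with Suc show ?case by simp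
qed simp

text \<open>The collection step: on its way to the left, \<open>x k [^] b\<close> passes each
  \<open>x i [^] fst r i\<close> with \<open>i \<le> m < k\<close> and leaves behind the power of
  \<open>z (i, k)\<close> with exponent \<open>fst r i * b\<close>. These central factors form a
  column.\<close>

lemma word_x:
  assumes "m < k"
  shows "word m r \<otimes> x k [^] (b::int) =
    x k [^] b \<otimes> word m r \<otimes> column m k (\<lambda>(i, k). fst r i * b)"
  using assms
proof (induction m)
  case (Suc m)
  define X where "X = x (Suc m) [^] fst r (Suc m)"
  define Y where "Y = x k [^] b"
  define Q where "Q = column m (Suc m) (snd r)"
  define Z where "Z = z (Suc m, k) [^] (fst r (Suc m) * b)"
  define C where "C = column m k (\<lambda>(i, k). fst r i * b)"
  define W where "W = word m r"
  have cl: "X \<in> carrier H" "Y \<in> carrier H" "Q \<in> carrier H" "Z \<in> carrier H" "C \<in> carrier H"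
    "W \<in> carrier H"
    by (simp_all add: X_def Y_def Q_def Z_def C_def W_def)
  have WY: "W \<otimes> Y = Y \<otimes> W \<otimes> C"
    using Suc by (simp add: W_def Y_def C_def)
  have QY: "Q \<otimes> Y = Y \<otimes> Q"
    unfolding Q_def Y_def by (intro commutes_int_pow column_x) auto
  have XY: "X \<otimes> Y = Y \<otimes> X \<otimes> Z"
    unfolding X_def Y_def Z_def using Suc.prems
    by (intro int_pow_commutator x_x z_x) auto
  have "word m r \<otimes> Z = Z \<otimes> word m r"
    unfolding Z_def by (intro commutes_int_pow word_commutes[symmetric] z_z z_x) auto
  then have ZW: "Z \<otimes> W = W \<otimes> Z" by (simp add: W_def)
  have ZQ: "Q \<otimes> Z = Z \<otimes> Q"
    unfolding Z_def Q_def by (intro commutes_int_pow column_z) auto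
  \<comment> \<open>\<open>Y\<close> passes \<open>W\<close>, \<open>Q\<close> and \<open>X\<close>
    in turn; then the new factor \<open>Z\<close> moves right to join \<open>C\<close>, and
    \<open>Z \<otimes> C\<close> is the column of length \<open>Suc m\<close>.\<close>
  have "X \<otimes> Q \<otimes> W \<otimes> Y = X \<otimes> (Q \<otimes> (Y \<otimes> (W \<otimes> C)))"
    using WY cl by (simp add: m_assoc)
  also have "\<dots> = X \<otimes> Y \<otimes> (Q \<otimes> (W \<otimes> C))"
    using QY cl by (simp add: m_assoc commutes_left)
  also have "\<dots> = Y \<otimes> (X \<otimes> (Z \<otimes> (Q \<otimes> (W \<otimes> C))))"
    using cl by (simp add: XY m_assoc)
  also have "\<dots> = Y \<otimes> (X \<otimes> (Q \<otimes> (W \<otimes> (Z \<otimes> C))))"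
    using cl commutes_left[OF ZQ[symmetric]] commutes_left[OF ZW] by simp
  finally show ?case
    using cl by (simp add: m_assoc X_def Y_def Q_def Z_def C_def W_def)
qed simp

text \<open>Words multiply by the law of the free nilpotent group. The only collision in the
  induction is the top power of the second word with the lower letters of the first, and by
  \<open>word_x\<close> it yields exactly the terms \<open>fst r j * fst s k\<close> with
  \<open>j < k\<close>.\<close>

lemma word_mult:
  "word m r \<otimes> word m s =
    word m (\<lambda>i. fst r i + fst s i, \<lambda>(j, k). snd r (j, k) + snd s (j, k) + fst r j * fst s k)"
    (is "_ = word m ?rs")
proof (induction m)
  case (Suc m)
  define X where "X = x (Suc m) [^] fst r (Suc m)"
  define Y where "Y = x (Suc m) [^] fst s (Suc m)"
  define Q where "Q = column m (Suc m) (snd r)"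
  define R where "R = column m (Suc m) (snd s)"
  define C where "C = column m (Suc m) (\<lambda>(i, k). fst r i * fst s (Suc m))"
  define V where "V = word m r"
  define W where "W = word m s"
  have cl: "X \<in> carrier H" "Y \<in> carrier H" "Q \<in> carrier H" "R \<in> carrier H" "C \<in> carrier H"
    "V \<in> carrier H" "W \<in> carrier H"
    by (simp_all add: X_def Y_def Q_def R_def C_def V_def W_def)
  have VY: "V \<otimes> Y = Y \<otimes> V \<otimes> C"
    unfolding V_def Y_def C_def by (rule word_x) simp
  have QY: "Q \<otimes> Y = Y \<otimes> Q"
    unfolding Q_def Y_def by (intro commutes_int_pow column_x) auto
  have CR: "R \<otimes> C = C \<otimes> R" and CV: "C \<otimes> V = V \<otimes> C" and RV: "R \<otimes> V = V \<otimes> R"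
    unfolding C_def R_def V_def by (intro column_commutes column_word column_z; simp)+
  \<comment> \<open>A column reads only pairs with second component \<open>Suc m\<close>, so the
    factor \<open>fst s k\<close> may be frozen to \<open>fst s (Suc m)\<close> and the three
    summands separated by \<open>column_add\<close>.\<close>
  have col: "column j (Suc m) (snd ?rs) =
      column j (Suc m) (snd r) \<otimes> column j (Suc m) (snd s) \<otimes>
      column j (Suc m) (\<lambda>(i, k). fst r i * fst s (Suc m))" for j
  proof -
    have "column j (Suc m) (snd ?rs) =
      column j (Suc m) (\<lambda>p. (snd r p + snd s p) + (case p of (i, k) \<Rightarrow> fst r i * fst s (Suc m)))"
      by (induction j) auto
    then show ?thesis by (simp only: column_add)
  qed
  have "X \<otimes> Q \<otimes> V \<otimes> (Y \<otimes> R \<otimes> W) = X \<otimes> (Q \<otimes> (V \<otimes> Y \<otimes> (R \<otimes> W)))"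
    using cl by (simp add: m_assoc)
  also have "\<dots> = X \<otimes> (Y \<otimes> (Q \<otimes> (V \<otimes> (C \<otimes> (R \<otimes> W)))))"
    using cl QY by (simp add: VY m_assoc commutes_left)
  also have "\<dots> = X \<otimes> Y \<otimes> (Q \<otimes> R \<otimes> C) \<otimes> (V \<otimes> W)"
    using cl commutes_left[OF CR] commutes_left[OF CV] commutes_left[OF RV]
    by (simp add: m_assoc)
  finally show ?case
    using Suc.IH cl col
    by (simp add: int_pow_mult X_def Y_def Q_def R_def C_def V_def W_def)
qed simp

end

text \<open>Words are built from products and powers only. This will be applied to the projection of
  a central extension.\<close>

lemma hom_word:
  assumes "class2_system H x z" "class2_system K x' z'" "h \<in> hom H K"
    and "\<And>i. h (x i) = x' i" "\<And>p. h (z p) = z' p"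
  shows "h (class2_system.word H x z m r) = class2_system.word K x' z' m r"
proof -
  interpret H: class2_system H x z by fact
  interpret K: class2_system K x' z' by fact
  interpret h: group_hom H K h
    by unfold_locales fact
  have "h (H.column j k e) = K.column j k e" for j k e
    by (induction j) (simp_all add: h.hom_int_pow assms)
  then show ?thesis
    by (induction m) (simp_all add: h.hom_int_pow assms)
qed

section \<open>Generators and normal form of the free nilpotent group\<close>

text \<open>For \<open>i\<close> outside \<open>{1..n}\<close> this is the identity, which makes the
  family of generators total.\<close>

definition axis_elem :: "nat \<Rightarrow> nat \<Rightarrow> int \<Rightarrow> tup" where
  "axis_elem n i a = (\<lambda>m\<in>{1..n}. if m = i then a else 0, \<lambda>p\<in>index_pairs n. 0)"

definition central_elem :: "nat \<Rightarrow> nat \<times> nat \<Rightarrow> int \<Rightarrow> tup" where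
  "central_elem n p a = (\<lambda>m\<in>{1..n}. 0, \<lambda>q\<in>index_pairs n. if q = p then a else 0)"

lemma free_nil2_simps:
  "r \<in> carrier (free_nil2 n) \<longleftrightarrow> fst r \<in> extensional {1..n} \<and> snd r \<in> extensional (index_pairs n)"
  "r \<otimes>\<^bsub>free_nil2 n\<^esub> s = (\<lambda>i\<in>{1..n}. fst r i + fst s i,
     \<lambda>(j, k)\<in>index_pairs n. snd r (j, k) + snd s (j, k) + fst r j * fst s k)"
  "\<one>\<^bsub>free_nil2 n\<^esub> = (\<lambda>i\<in>{1..n}. 0, \<lambda>p\<in>index_pairs n. 0)"
  by (auto simp: free_nil2_def PiE_def mem_Times_iff)

lemma index_pairs_iff [simp]: "(j, k) \<in> index_pairs n \<longleftrightarrow> 1 \<le> j \<and> j < k \<and> k \<le> n"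
  by (simp add: index_pairs_def)

lemma axis_elem_closed [simp]: "axis_elem n i a \<in> carrier (free_nil2 n)"
  by (simp add: free_nil2_simps axis_elem_def)

lemma central_elem_closed [simp]: "central_elem n p a \<in> carrier (free_nil2 n)"
  by (simp add: free_nil2_simps central_elem_def)

text \<open>The mixed terms of the multiplication vanish when both factors lie on one axis. Hence
  \<open>axis_elem n i\<close> is a homomorphism from the integers and respects powers of
  \<open>1\<close>.\<close>

lemma axis_elem_int_pow: "axis_elem n i 1 [^]\<^bsub>free_nil2 n\<^esub> a = axis_elem n i a" for a :: int
proof -
  have "axis_elem n i \<in> hom integer_group (free_nil2 n)"
  proof (rule homI)
    fix a b :: int
    show "axis_elem n i (a \<otimes>\<^bsub>integer_group\<^esub> b) =
        axis_elem n i a \<otimes>\<^bsub>free_nil2 n\<^esub> axis_elem n i b"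
      by (auto simp: free_nil2_simps(2) axis_elem_def fun_eq_iff restrict_def)
  qed simp
  from hom_int_pow[OF this _ group_integer_group group_free_nil2, of 1 a] show ?thesis by simp
qed

lemma central_elem_int_pow: "central_elem n p 1 [^]\<^bsub>free_nil2 n\<^esub> a = central_elem n p a" for a :: int
proof -
  have "central_elem n p \<in> hom integer_group (free_nil2 n)"
  proof (rule homI)
    fix a b :: int
    show "central_elem n p (a \<otimes>\<^bsub>integer_group\<^esub> b) =
        central_elem n p a \<otimes>\<^bsub>free_nil2 n\<^esub> central_elem n p b"
      by (auto simp: free_nil2_simps(2) central_elem_def fun_eq_iff restrict_def)
  qed simp
  from hom_int_pow[OF this _ group_integer_group group_free_nil2, of 1 a] show ?thesis by simp
qed

lemma central_elem_commutes:
  assumes "r \<in> carrier (free_nil2 n)"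
  shows "central_elem n p a \<otimes>\<^bsub>free_nil2 n\<^esub> r = r \<otimes>\<^bsub>free_nil2 n\<^esub> central_elem n p a"
  by (auto simp: free_nil2_simps(2) central_elem_def fun_eq_iff restrict_def)

lemma axis_elem_commutator:
  assumes "j < k"
  shows "axis_elem n j 1 \<otimes>\<^bsub>free_nil2 n\<^esub> axis_elem n k 1 =
    axis_elem n k 1 \<otimes>\<^bsub>free_nil2 n\<^esub> axis_elem n j 1 \<otimes>\<^bsub>free_nil2 n\<^esub> central_elem n (j, k) 1"
  using assms
  by (auto simp: free_nil2_simps(2) central_elem_def axis_elem_def fun_eq_iff restrict_def)

lemma class2_system_free_nil2:
  "class2_system (free_nil2 n) (\<lambda>i. axis_elem n i 1) (\<lambda>p. central_elem n p 1)"
proof -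
  interpret group "free_nil2 n" by (rule group_free_nil2)
  show ?thesis
    by unfold_locales (auto intro!: central_elem_commutes axis_elem_commutator)
qed

text \<open>The letters appear with decreasing index, whereas mixed terms arise only when a smaller
  index stands to the left of a larger one. So coordinates simply accumulate, and partial words are
  truncations of \<open>r\<close>.\<close>

lemma word_free_nil2:
  assumes "r \<in> carrier (free_nil2 n)"
  shows "class2_system.word (free_nil2 n) (\<lambda>i. axis_elem n i 1) (\<lambda>p. central_elem n p 1) n r = r"
proof -
  interpret class2_system "free_nil2 n" "\<lambda>i. axis_elem n i 1" "\<lambda>p. central_elem n p 1"
    by (rule class2_system_free_nil2)
  have col: "column j k e =
      (\<lambda>m\<in>{1..n}. 0, \<lambda>(i, k')\<in>index_pairs n. if k' = k \<and> i \<le> j then e (i, k) else 0)" for j k e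
  proof (induction j)
    case 0
    show ?case by (auto simp: free_nil2_simps(3) fun_eq_iff restrict_def)
  next
    case (Suc j)
    show ?case
      unfolding column.simps Suc central_elem_int_pow
      by (auto simp: central_elem_def free_nil2_simps(2) fun_eq_iff
          restrict_def le_Suc_eq)
  qed
  have "word m r = (\<lambda>i\<in>{1..n}. if i \<le> m then fst r i else 0,
      \<lambda>(j, k)\<in>index_pairs n. if k \<le> m then snd r (j, k) else 0)" for m
  proof (induction m)
    case 0
    show ?case by (auto simp: free_nil2_simps(3) fun_eq_iff restrict_def)
  next
    case (Suc m)
    show ?case
      unfolding word.simps Suc col axis_elem_int_pow
      by (auto simp: axis_elem_def free_nil2_simps(2) fun_eq_iff
          restrict_def le_Suc_eq)
  qed
  then show ?thesis
    using assms by (auto simp: free_nil2_simps(1) extensional_def fun_eq_iff prod_eq_iff)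
qed

section \<open>Splitting of central extensions\<close>

text \<open>Since cocycles are normalised, the neutral element has first coordinate
  \<open>1\<close>.\<close>

definition central_extension ::
    "('a, 'b) monoid_scheme \<Rightarrow> ('a \<times> 'a \<Rightarrow> complex) \<Rightarrow> (complex \<times> 'a) monoid" where
  "central_extension G \<sigma> =
     \<lparr>carrier = circle \<times> carrier G,
      mult = (\<lambda>a b. (fst a * fst b * \<sigma> (snd a, snd b), snd a \<otimes>\<^bsub>G\<^esub> snd b)),
      one = (1, \<one>\<^bsub>G\<^esub>)\<rparr>"

lemma central_extension_simps:
  "a \<in> carrier (central_extension G \<sigma>) \<longleftrightarrow> norm (fst a) = 1 \<and> snd a \<in> carrier G"
  "a \<otimes>\<^bsub>central_extension G \<sigma>\<^esub> b = (fst a * fst b * \<sigma> (snd a, snd b), snd a \<otimes>\<^bsub>G\<^esub> snd b)"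
  "\<one>\<^bsub>central_extension G \<sigma>\<^esub> = (1, \<one>\<^bsub>G\<^esub>)"
  by (simp_all add: central_extension_def mem_Times_iff)

lemma two_cocyclesD:
  assumes "\<sigma> \<in> two_cocycles G" "r \<in> carrier G"
  shows "\<sigma> (r, \<one>\<^bsub>G\<^esub>) = 1" "\<sigma> (\<one>\<^bsub>G\<^esub>, r) = 1"
    "\<lbrakk>s \<in> carrier G; t \<in> carrier G\<rbrakk> \<Longrightarrow>
       \<sigma> (r, s) * \<sigma> (r \<otimes>\<^bsub>G\<^esub> s, t) = \<sigma> (r, s \<otimes>\<^bsub>G\<^esub> t) * \<sigma> (s, t)"
  using assms by (auto simp: two_cocycles_def)

lemma group_central_extension:
  assumes "group G" "\<sigma> \<in> two_cocycles G"
  shows "group (central_extension G \<sigma>)"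
proof -
  interpret group G by fact
  note simps = central_extension_simps norm_mult two_cocycles_norm[OF assms(2)]
  show ?thesis
  proof (rule groupI)
    fix a b c
    assume abc: "a \<in> carrier (central_extension G \<sigma>)" "b \<in> carrier (central_extension G \<sigma>)"
      "c \<in> carrier (central_extension G \<sigma>)"
    then have "\<sigma> (snd a, snd b) * \<sigma> (snd a \<otimes>\<^bsub>G\<^esub> snd b, snd c) =
        \<sigma> (snd a, snd b \<otimes>\<^bsub>G\<^esub> snd c) * \<sigma> (snd b, snd c)"
      by (intro two_cocyclesD[OF assms(2)]) (simp_all add: simps)
    then show "a \<otimes>\<^bsub>central_extension G \<sigma>\<^esub> b \<otimes>\<^bsub>central_extension G \<sigma>\<^esub> c =
        a \<otimes>\<^bsub>central_extension G \<sigma>\<^esub> (b \<otimes>\<^bsub>central_extension G \<sigma>\<^esub> c)"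
      using abc by (simp add: simps m_assoc mult_ac)
  next
    fix a assume a: "a \<in> carrier (central_extension G \<sigma>)"
    let ?i = "inv\<^bsub>G\<^esub> (snd a)"
    \<comment> \<open>On the circle \<open>cnj\<close> inverts; the second factor cancels the
      cocycle value that the product with \<open>a\<close> introduces.\<close>
    let ?b = "(cnj (fst a) * cnj (\<sigma> (?i, snd a)), ?i)"
    have n: "norm (fst a) = 1" "norm (\<sigma> (?i, snd a)) = 1"
      using a by (simp_all add: simps)
    have "cnj (fst a) * cnj (\<sigma> (?i, snd a)) * fst a * \<sigma> (?i, snd a) =
        (fst a * cnj (fst a)) * (\<sigma> (?i, snd a) * cnj (\<sigma> (?i, snd a)))"
      by (simp add: mult_ac)
    then show "\<exists>b\<in>carrier (central_extension G \<sigma>).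
        b \<otimes>\<^bsub>central_extension G \<sigma>\<^esub> a = \<one>\<^bsub>central_extension G \<sigma>\<^esub>"
      using a n by (intro bexI[of _ ?b]) (simp_all add: simps norm_one_mult_cnj)
  qed (simp_all add: simps two_cocyclesD[OF assms(2)])
qed

lemma snd_hom_central_extension: "snd \<in> hom (central_extension G \<sigma>) G"
  by (rule homI) (simp_all add: central_extension_simps)

text \<open>For a section \<open>r \<mapsto> (\<beta> r, r)\<close>, being a homomorphism means that
  \<open>\<beta>\<close> of a product is \<open>\<beta> r * \<beta> s * \<sigma> (r, s)\<close>;
  dividing by the left side exhibits \<open>\<beta>\<close> as a similarity to the constant
  cocycle.\<close>

lemma trivial_if_section:
  assumes "group G" "\<sigma> \<in> two_cocycles G"
    and h: "h \<in> hom G (central_extension G \<sigma>)" "\<And>r. r \<in> carrier G \<Longrightarrow> snd (h r) = r"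
  shows "(\<sigma>, \<lambda>p\<in>carrier G \<times> carrier G. 1) \<in> similarity G"
proof -
  interpret group G by fact
  have n: "norm (fst (h r)) = 1" if "r \<in> carrier G" for r
    using h(1) that by (auto simp: hom_def Pi_iff central_extension_simps)
  have m: "fst (h (r \<otimes>\<^bsub>G\<^esub> s)) = fst (h r) * fst (h s) * \<sigma> (r, s)"
    if "r \<in> carrier G" "s \<in> carrier G" for r s
    using hom_mult[OF h(1) that] h(2) that by (simp add: central_extension_simps)
  have "1 = fst (h r) * fst (h s) * cnj (fst (h (r \<otimes>\<^bsub>G\<^esub> s))) * \<sigma> (r, s)"
    if "r \<in> carrier G" "s \<in> carrier G" for r s
  proof -
    have "1 = fst (h (r \<otimes>\<^bsub>G\<^esub> s)) * cnj (fst (h (r \<otimes>\<^bsub>G\<^esub> s)))"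
      using that by (intro norm_one_mult_cnj[symmetric] n) simp
    then show ?thesis
      unfolding m[OF that] by (simp add: mult_ac)
  qed
  then have "\<forall>r\<in>carrier G. \<forall>s\<in>carrier G. (\<lambda>p\<in>carrier G \<times> carrier G. 1) (r, s) =
      fst (h r) * fst (h s) * cnj (fst (h (r \<otimes>\<^bsub>G\<^esub> s))) * \<sigma> (r, s)"
    by (intro ballI) (simp only: restrict_apply' SigmaI)
  moreover have "(\<lambda>r. fst (h r)) \<in> carrier G \<rightarrow> circle"
    using n by simp
  ultimately show ?thesis
    using assms(2) one_two_cocycle[OF assms(1)]
    unfolding similarity_def mem_Collect_eq prod.case
    by (intro conjI bexI[of _ "\<lambda>r. fst (h r)"])
qed

text \<open>The two products differ only in the cocycle value, since the non-zero scalar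
  \<open>fst a * fst b\<close> cancels.\<close>

lemma central_extension_commute_iff:
  assumes "\<sigma> \<in> two_cocycles G" "snd a \<otimes>\<^bsub>G\<^esub> snd b = snd b \<otimes>\<^bsub>G\<^esub> snd a"
    and "a \<in> carrier (central_extension G \<sigma>)" "b \<in> carrier (central_extension G \<sigma>)"
  shows "a \<otimes>\<^bsub>central_extension G \<sigma>\<^esub> b = b \<otimes>\<^bsub>central_extension G \<sigma>\<^esub> a \<longleftrightarrow>
    \<sigma> (snd a, snd b) = \<sigma> (snd b, snd a)"
proof -
  have "fst a \<noteq> 0" "fst b \<noteq> 0"
    using assms(3,4) by (auto simp: central_extension_simps)
  then show ?thesis
    using assms(2) by (auto simp: central_extension_simps)
qed

text \<open>The section is \<open>r \<mapsto> word n r\<close>, formed in the extension: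
  \<open>word_mult\<close> makes it a homomorphism, and \<open>hom_word\<close> with
  \<open>word_free_nil2\<close> makes it a section. The work lies in showing that the lifts form a
  \<open>class2_system\<close>.\<close>

lemma trivial_if_commuting:
  assumes \<sigma>: "\<sigma> \<in> two_cocycles (free_nil2 n)"
    and comm: "\<And>i j k. (i, j, k) \<in> param_index n \<Longrightarrow>
      \<sigma> (axis_elem n i 1, central_elem n (j, k) 1) = \<sigma> (central_elem n (j, k) 1, axis_elem n i 1)"
  shows "(\<sigma>, \<lambda>p\<in>carrier (free_nil2 n) \<times> carrier (free_nil2 n). 1) \<in> similarity (free_nil2 n)"
proof -
  define G where "G = free_nil2 n"
  define E where "E = central_extension G \<sigma>"
  define u where "u = (\<lambda>i. axis_elem n i 1)"
  define v where "v = (\<lambda>p. central_elem n p 1)"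
  interpret G: class2_system G u v
    unfolding G_def u_def v_def by (rule class2_system_free_nil2)
  interpret E: group E
    unfolding E_def using \<sigma> G.is_group by (intro group_central_extension) (simp_all add: G_def)
  interpret snd: group_hom E G snd
    by unfold_locales (simp add: E_def snd_hom_central_extension)
  define x where "x = (\<lambda>i. (1 :: complex, u i))"
  \<comment> \<open>Taking the commutator of the lifts, and not just any lift of
    \<open>v (j, k)\<close>, makes the relation \<open>x_x\<close> hold exactly and not only up to a
    scalar.\<close>
  define z where "z = (\<lambda>(j, k). if j < k
    then inv\<^bsub>E\<^esub> (x k \<otimes>\<^bsub>E\<^esub> x j) \<otimes>\<^bsub>E\<^esub> (x j \<otimes>\<^bsub>E\<^esub> x k) else \<one>\<^bsub>E\<^esub>)"
  have z_pair: "z (j, k) = (if j < k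
    then inv\<^bsub>E\<^esub> (x k \<otimes>\<^bsub>E\<^esub> x j) \<otimes>\<^bsub>E\<^esub> (x j \<otimes>\<^bsub>E\<^esub> x k) else \<one>\<^bsub>E\<^esub>)" for j k
    by (simp add: z_def)
  have x_closed [simp]: "x i \<in> carrier E" for i
    using G.x_closed by (simp add: E_def x_def central_extension_simps)
  have z_closed [simp]: "z p \<in> carrier E" for p
    by (cases p) (simp add: z_pair)
  have snd_x: "snd (x i) = u i" for i
    by (simp add: x_def)
  have snd_z: "snd (z p) = v p" for p
  proof (cases p)
    case (Pair j k)
    show ?thesis
    proof (cases "j < k")
      case True
      then show ?thesis
        using G.x_x[OF True] Pair by (simp add: z_pair snd_x G.m_assoc G.inv_solve_left')
    next
      case False
      then show ?thesis
        using Pair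
        by (auto simp: z_pair v_def G_def free_nil2_simps(3) central_elem_def fun_eq_iff restrict_def)
    qed
  qed
  have x_x: "x j \<otimes>\<^bsub>E\<^esub> x k = x k \<otimes>\<^bsub>E\<^esub> x j \<otimes>\<^bsub>E\<^esub> z (j, k)" if "j < k" for j k
    using that by (simp add: z_pair) (metis E.inv_solve_left E.inv_closed E.m_closed x_closed)
  have z_x_iff: "z p \<otimes>\<^bsub>E\<^esub> x i = x i \<otimes>\<^bsub>E\<^esub> z p \<longleftrightarrow> \<sigma> (v p, u i) = \<sigma> (u i, v p)" for p i
    using central_extension_commute_iff[of \<sigma> G "z p" "x i"] \<sigma> G.z_x z_closed x_closed
    by (simp add: snd_z snd_x flip: E_def G_def)
  have le: "z (j, k) \<otimes>\<^bsub>E\<^esub> x i = x i \<otimes>\<^bsub>E\<^esub> z (j, k)" if "i \<le> k" for i j k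
  proof (cases "(i, j, k) \<in> param_index n")
    case True
    then show ?thesis
      using comm[OF True] by (simp add: z_x_iff u_def v_def)
  next
    case False
    \<comment> \<open>In these cases one of \<open>u i\<close> and \<open>v (j, k)\<close> is the
      identity, where a normalised cocycle is symmetric.\<close>
    then consider "i = 0" | "(j, k) \<notin> index_pairs n"
      using \<open>i \<le> k\<close> by (auto simp: param_index_def)
    then have "u i = \<one>\<^bsub>G\<^esub> \<or> v (j, k) = \<one>\<^bsub>G\<^esub>"
      by cases (auto simp: u_def v_def axis_elem_def central_elem_def G_def free_nil2_simps(3)
          fun_eq_iff restrict_def)
    moreover have "\<sigma> (r, \<one>\<^bsub>G\<^esub>) = \<sigma> (\<one>\<^bsub>G\<^esub>, r)" if "r \<in> carrier G" for r
      using two_cocyclesD(1,2)[OF \<sigma>] that by (simp add: G_def)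
    ultimately show ?thesis
      unfolding z_x_iff by (metis G.x_closed G.z_closed)
  qed
  have z_x: "z p \<otimes>\<^bsub>E\<^esub> x i = x i \<otimes>\<^bsub>E\<^esub> z p" for p i
  proof (cases p)
    case (Pair j k)
    show ?thesis
    proof (cases "i \<le> k \<or> \<not> j < k")
      case True
      then show ?thesis
      proof
        assume "\<not> j < k"
        then show ?thesis using Pair by (simp add: z_pair)
      qed (use le Pair in blast)
    next
      case False
      \<comment> \<open>Hall--Witt with \<open>w\<close> equal to \<open>x i\<close>: the inner
        commutators \<open>z (j, i)\<close> and \<open>z (k, i)\<close> have larger index
        \<open>i\<close>, so \<open>le\<close> makes them commute with \<open>x j\<close>,
        \<open>x k\<close> and \<open>x i\<close>.\<close>
      then have "j < k" "j < i" "k < i" by auto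
      then have "z (j, k) \<otimes>\<^bsub>E\<^esub> x i = x i \<otimes>\<^bsub>E\<^esub> z (j, k)"
        by (intro E.Hall_Witt_central[of "x j" "x k" "z (j, k)" "x i" "z (j, i)" "z (k, i)"])
          (simp_all only: x_x le x_closed z_closed less_imp_le order_refl)
      then show ?thesis using Pair by simp
    qed
  qed
  have z_z: "z p \<otimes>\<^bsub>E\<^esub> z q = z q \<otimes>\<^bsub>E\<^esub> z p" for p q
  proof (cases q)
    case (Pair j k)
    have "z p \<otimes>\<^bsub>E\<^esub> (inv\<^bsub>E\<^esub> (x k \<otimes>\<^bsub>E\<^esub> x j) \<otimes>\<^bsub>E\<^esub> (x j \<otimes>\<^bsub>E\<^esub> x k)) =
        inv\<^bsub>E\<^esub> (x k \<otimes>\<^bsub>E\<^esub> x j) \<otimes>\<^bsub>E\<^esub> (x j \<otimes>\<^bsub>E\<^esub> x k) \<otimes>\<^bsub>E\<^esub> z p"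
      by (intro E.commutes_mult E.commutes_inv z_x) auto
    then show ?thesis
      unfolding Pair z_pair[of j k] by (cases "j < k")
        (simp_all only: if_True if_False z_closed E.l_one E.r_one)
  qed
  interpret E: class2_system E x z
    by unfold_locales (fact x_closed z_closed z_x z_z x_x)+
  have section_snd: "snd (E.word n r) = r" if "r \<in> carrier G" for r
  proof -
    have "snd (E.word n r) = G.word n r"
      by (rule hom_word[OF E.class2_system_axioms G.class2_system_axioms snd.homh snd_x snd_z])
    also have "\<dots> = r"
      using word_free_nil2[of r n] that by (simp add: G_def u_def v_def)
    finally show ?thesis .
  qed
  \<comment> \<open>\<open>word_mult\<close> speaks of unrestricted coordinate functions and the
    group law of restricted ones; words of length \<open>n\<close> read only indices in
    range.\<close>
  have "E.word n (r \<otimes>\<^bsub>G\<^esub> s) = E.word n r \<otimes>\<^bsub>E\<^esub> E.word n s" for r s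
    unfolding E.word_mult G_def free_nil2_simps(2) by (rule E.word_cong) auto
  then have "E.word n \<in> hom G E"
    by (intro homI) auto
  from trivial_if_section[OF G.is_group _ this[unfolded E_def] section_snd[unfolded E_def]]
  show ?thesis using \<sigma> by (simp add: G_def)
qed

section \<open>The parametrised cocycles\<close>

text \<open>\<open>param_cocycle\<close> is one restricted product, while
  \<open>cocycle_mult\<close> restricts at every step. This lemma and the next reduce the cocycle
  property to single factors.\<close>

lemma restrict_prod_two_cocycles:
  assumes "group G" "\<And>t. t \<in> A \<Longrightarrow> restrict (f t) (carrier G \<times> carrier G) \<in> two_cocycles G"
  shows "(\<lambda>p\<in>carrier G \<times> carrier G. \<Prod>t\<in>A. f t p) \<in> two_cocycles G"
  using assms(2)
proof (induction A rule: infinite_finite_induct)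
  case (insert t A)
  have "(\<lambda>p\<in>carrier G \<times> carrier G. \<Prod>t\<in>insert t A. f t p) =
      cocycle_mult G (restrict (f t) (carrier G \<times> carrier G))
        (\<lambda>p\<in>carrier G \<times> carrier G. \<Prod>t\<in>A. f t p)"
    using insert.hyps by (auto simp: cocycle_mult_def)
  then show ?case
    using cocycle_mult_closed[OF assms(1) insert.prems[of t] insert.IH[OF insert.prems]]
    by (simp only: insertI1 insertI2)
qed (simp_all add: one_two_cocycle[OF assms(1)])

lemma restrict_mult_two_cocycles:
  assumes "group G" "restrict f (carrier G \<times> carrier G) \<in> two_cocycles G"
    "restrict g (carrier G \<times> carrier G) \<in> two_cocycles G"
  shows "(\<lambda>p\<in>carrier G \<times> carrier G. f p * g p) \<in> two_cocycles G"
proof -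
  have "(\<lambda>p\<in>carrier G \<times> carrier G. f p * g p) =
      cocycle_mult G (restrict f (carrier G \<times> carrier G)) (restrict g (carrier G \<times> carrier G))"
    by (auto simp: cocycle_mult_def)
  then show ?thesis
    using assms by (simp add: cocycle_mult_closed)
qed

text \<open>Powers of a fixed scalar turn addition into multiplication, so each factor reduces to a
  polynomial identity for an additive integer cocycle.\<close>

lemma restrict_power_int_two_cocycles:
  fixes e :: "'a \<times> 'a \<Rightarrow> int"
  assumes "group G" "norm l = 1"
    and "\<And>r s t. \<lbrakk>r \<in> carrier G; s \<in> carrier G; t \<in> carrier G\<rbrakk> \<Longrightarrow>
      e (r, s) + e (r \<otimes>\<^bsub>G\<^esub> s, t) = e (r, s \<otimes>\<^bsub>G\<^esub> t) + e (s, t)"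
    and "\<And>r. r \<in> carrier G \<Longrightarrow> e (r, \<one>\<^bsub>G\<^esub>) = 0" "\<And>r. r \<in> carrier G \<Longrightarrow> e (\<one>\<^bsub>G\<^esub>, r) = 0"
  shows "(\<lambda>p\<in>carrier G \<times> carrier G. l powi e p) \<in> two_cocycles G"
proof -
  interpret group G by fact
  have "l \<noteq> 0" using assms(2) by auto
  then have "l powi e (r, s) * l powi e (r \<otimes>\<^bsub>G\<^esub> s, t) = l powi e (r, s \<otimes>\<^bsub>G\<^esub> t) * l powi e (s, t)"
    if "r \<in> carrier G" "s \<in> carrier G" "t \<in> carrier G" for r s t
    using assms(3)[OF that] by (simp flip: power_int_add)
  then show ?thesis
    using assms by (auto simp: two_cocycles_def norm_power_int)
qed

lemma mult_triangle_div_2: "(a * b * (b - 1)) div 2 = a * (b * (b - 1) div 2)" for a b :: int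
  by (subst div_mult_swap) (auto simp: mult.assoc)

text \<open>The cross term \<open>a * b\<close> is what lets the halved terms of the exponents
  absorb the products \<open>fst r j * fst s k\<close> from the group law.\<close>

lemma triangle_div_2_add:
  "((a + b) * (a + b - 1)) div 2 = a * (a - 1) div 2 + b * (b - 1) div 2 + a * b" for a b :: int
proof -
  have "(a + b) * (a + b - 1) = a * (a - 1) + (b * (b - 1) + (a * b) * 2)"
    by (simp add: algebra_simps)
  moreover have "even (a * (a - 1))" "even (b * (b - 1))"
    by auto
  ultimately show ?thesis
    by (simp add: div_plus_div_distrib_dvd_left)
qed

text \<open>The suffix of each exponent names its parameter, while the arguments are always
  increasing: \<open>exponent_jik i j k\<close> belongs to \<open>lam (j, i, k)\<close>.\<close>

definition exponent_ijk :: "nat \<Rightarrow> nat \<Rightarrow> nat \<Rightarrow> tup \<times> tup \<Rightarrow> int" where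
  "exponent_ijk i j k = (\<lambda>(r, s). snd s (j, k) * fst r i + fst s k * snd r (i, j))"

definition exponent_jik :: "nat \<Rightarrow> nat \<Rightarrow> nat \<Rightarrow> tup \<times> tup \<Rightarrow> int" where
  "exponent_jik i j k =
     (\<lambda>(r, s). snd s (i, k) * fst r j + fst s k * (fst r i * fst r j - snd r (i, j)))"

definition exponent_jjk :: "nat \<Rightarrow> nat \<Rightarrow> tup \<times> tup \<Rightarrow> int" where
  "exponent_jjk j k =
     (\<lambda>(r, s). snd s (j, k) * fst r j + (fst s k * fst r j * (fst r j - 1)) div 2)"

definition exponent_kjk :: "nat \<Rightarrow> nat \<Rightarrow> tup \<times> tup \<Rightarrow> int" where
  "exponent_kjk j k = (\<lambda>(r, s). fst r k * (snd s (j, k) + fst r j * fst s k) +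
     (fst r j * fst s k * (fst s k - 1)) div 2)"

lemmas exponent_defs = exponent_ijk_def exponent_jik_def exponent_jjk_def exponent_kjk_def

definition strict_triples :: "nat \<Rightarrow> (nat \<times> nat \<times> nat) set" where
  "strict_triples n = {(i, j, k). 1 \<le> i \<and> i < j \<and> j < k \<and> k \<le> n}"

lemma finite_index [simp]: "finite (strict_triples n)" "finite (index_pairs n)"
proof -
  have "strict_triples n \<subseteq> {1..n} \<times> {1..n} \<times> {1..n}" "index_pairs n \<subseteq> {1..n} \<times> {1..n}"
    by (auto simp: strict_triples_def)
  then show "finite (strict_triples n)" "finite (index_pairs n)"
    by (auto elim: finite_subset)
qed

lemma param_cocycle_eq:
  "param_cocycle n lam = (\<lambda>p\<in>carrier (free_nil2 n) \<times> carrier (free_nil2 n).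
     (\<Prod>(i, j, k)\<in>strict_triples n.
        lam (i, j, k) powi exponent_ijk i j k p * lam (j, i, k) powi exponent_jik i j k p) *
     (\<Prod>(j, k)\<in>index_pairs n.
        lam (j, j, k) powi exponent_jjk j k p * lam (k, j, k) powi exponent_kjk j k p))"
  unfolding param_cocycle_def exponent_defs strict_triples_def index_pairs_def
  by (auto simp: restrict_def fun_eq_iff)

lemma param_cocycle_two_cocycles:
  assumes lam: "\<And>p. p \<in> param_index n \<Longrightarrow> norm (lam p) = 1"
  shows "param_cocycle n lam \<in> two_cocycles (free_nil2 n)"
proof -
  define C where "C = carrier (free_nil2 n) \<times> carrier (free_nil2 n)"
  note pow = restrict_power_int_two_cocycles[OF group_free_nil2]
  have e12: "(\<lambda>p\<in>C. lam (i, j, k) powi exponent_ijk i j k p) \<in> two_cocycles (free_nil2 n)"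
    "(\<lambda>p\<in>C. lam (j, i, k) powi exponent_jik i j k p) \<in> two_cocycles (free_nil2 n)"
    if "(i, j, k) \<in> strict_triples n" for i j k
  proof -
    have ijk: "1 \<le> i" "i < j" "j < k" "k \<le> n"
      using that by (auto simp: strict_triples_def)
    show "(\<lambda>p\<in>C. lam (i, j, k) powi exponent_ijk i j k p) \<in> two_cocycles (free_nil2 n)"
      unfolding C_def using ijk
      by (intro pow lam) (auto simp: param_index_def exponent_defs free_nil2_simps algebra_simps)
    show "(\<lambda>p\<in>C. lam (j, i, k) powi exponent_jik i j k p) \<in> two_cocycles (free_nil2 n)"
      unfolding C_def using ijk
      by (intro pow lam) (auto simp: param_index_def exponent_defs free_nil2_simps algebra_simps)
  qed
  have e34: "(\<lambda>p\<in>C. lam (j, j, k) powi exponent_jjk j k p) \<in> two_cocycles (free_nil2 n)"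
    "(\<lambda>p\<in>C. lam (k, j, k) powi exponent_kjk j k p) \<in> two_cocycles (free_nil2 n)"
    if "(j, k) \<in> index_pairs n" for j k
  proof -
    \<comment> \<open>With \<open>T\<close> opaque, the verification uses its addition rule only and
      meets no integer division.\<close>
    define T where "T a = a * (a - 1) div 2" for a :: int
    have T: "T (a + b) = T a + T b + a * b" "T 0 = 0" for a b
      by (simp_all add: T_def triangle_div_2_add)
    have jk: "1 \<le> j" "j < k" "k \<le> n"
      using that by auto
    have jjk: "exponent_jjk j k (r, s) = snd s (j, k) * fst r j + fst s k * T (fst r j)" for r s
      by (simp add: exponent_jjk_def T_def mult_triangle_div_2)
    have kjk: "exponent_kjk j k (r, s) =
        fst r k * (snd s (j, k) + fst r j * fst s k) + fst r j * T (fst s k)" for r s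
      by (simp add: exponent_kjk_def T_def mult_triangle_div_2)
    show "(\<lambda>p\<in>C. lam (j, j, k) powi exponent_jjk j k p) \<in> two_cocycles (free_nil2 n)"
      unfolding C_def using jk
      by (intro pow lam) (auto simp: param_index_def jjk free_nil2_simps T algebra_simps)
    show "(\<lambda>p\<in>C. lam (k, j, k) powi exponent_kjk j k p) \<in> two_cocycles (free_nil2 n)"
      unfolding C_def using jk
      by (intro pow lam) (auto simp: param_index_def kjk free_nil2_simps T algebra_simps)
  qed
  show ?thesis
    unfolding param_cocycle_eq
  proof (intro restrict_mult_two_cocycles restrict_prod_two_cocycles group_free_nil2)
    fix t assume "t \<in> strict_triples n"
    then show "(\<lambda>p\<in>carrier (free_nil2 n) \<times> carrier (free_nil2 n).
        case t of (i, j, k) \<Rightarrow> lam (i, j, k) powi exponent_ijk i j k p *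
          lam (j, i, k) powi exponent_jik i j k p) \<in> two_cocycles (free_nil2 n)"
      using restrict_mult_two_cocycles[OF group_free_nil2 e12[unfolded C_def]]
      by (cases t) simp
  next
    fix t assume "t \<in> index_pairs n"
    then show "(\<lambda>p\<in>carrier (free_nil2 n) \<times> carrier (free_nil2 n).
        case t of (j, k) \<Rightarrow> lam (j, j, k) powi exponent_jjk j k p *
          lam (k, j, k) powi exponent_kjk j k p) \<in> two_cocycles (free_nil2 n)"
      using restrict_mult_two_cocycles[OF group_free_nil2 e34[unfolded C_def]]
      by (cases t) simp
  qed
qed

text \<open>Each exponent reduces to its product of a central coordinate of the second argument with
  an axis coordinate of the first. Exactly one factor survives, in the cases \<open>i < j\<close>,
  \<open>j < i < k\<close>, \<open>i = j\<close> and \<open>i = k\<close> respectively.\<close>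

lemma param_cocycle_axis_central:
  assumes "(i, j, k) \<in> param_index n"
  shows "param_cocycle n lam (axis_elem n i 1, central_elem n (j, k) 1) = lam (i, j, k)"
proof -
  let ?l = "lam (i, j, k)"
  let ?p = "(axis_elem n i 1, central_elem n (j, k) 1)"
  have ijk: "1 \<le> i" "i \<le> k" "1 \<le> j" "j < k" "k \<le> n"
    using assms by (auto simp: param_index_def)
  have e: "exponent_ijk a b c ?p = (if (a, b, c) = (i, j, k) then 1 else 0)"
    "exponent_jik a b c ?p = (if (a, b, c) = (j, i, k) then 1 else 0)"
    if "(a, b, c) \<in> strict_triples n" for a b c
    using that by (simp_all add: exponent_defs strict_triples_def axis_elem_def central_elem_def)
  have e': "exponent_jjk b c ?p = (if b = i \<and> (b, c) = (j, k) then 1 else 0)"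
    "exponent_kjk b c ?p = (if c = i \<and> (b, c) = (j, k) then 1 else 0)"
    if "(b, c) \<in> index_pairs n" for b c
    using that by (simp_all add: exponent_defs axis_elem_def central_elem_def)
  have "(\<Prod>(a, b, c)\<in>strict_triples n.
      lam (a, b, c) powi exponent_ijk a b c ?p * lam (b, a, c) powi exponent_jik a b c ?p) =
    (\<Prod>t\<in>strict_triples n. (if t = (i, j, k) then ?l else 1) * (if t = (j, i, k) then ?l else 1))"
  proof (rule prod.cong[OF refl])
    fix t assume "t \<in> strict_triples n"
    moreover obtain a b c where t: "t = (a, b, c)" by (cases t)
    ultimately have abc: "(a, b, c) \<in> strict_triples n" by simp
    show "(case t of (a, b, c) \<Rightarrow>
        lam (a, b, c) powi exponent_ijk a b c ?p * lam (b, a, c) powi exponent_jik a b c ?p) =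
      (if t = (i, j, k) then ?l else 1) * (if t = (j, i, k) then ?l else 1)"
      unfolding t prod.case e[OF abc] if_distrib[of "power_int _"] power_int_0_right power_int_1_right
      by (intro arg_cong2[of _ _ _ _ times] if_cong refl) simp_all
  qed
  also have "\<dots> = (if (i, j, k) \<in> strict_triples n then ?l else 1) *
      (if (j, i, k) \<in> strict_triples n then ?l else 1)"
    by (simp only: prod.distrib prod.delta finite_index)
  finally have 1: "(\<Prod>(a, b, c)\<in>strict_triples n.
      lam (a, b, c) powi exponent_ijk a b c ?p * lam (b, a, c) powi exponent_jik a b c ?p) = \<dots>" .
  have "(\<Prod>(b, c)\<in>index_pairs n.
      lam (b, b, c) powi exponent_jjk b c ?p * lam (c, b, c) powi exponent_kjk b c ?p) =
    (\<Prod>t\<in>index_pairs n. if t = (j, k) then if i = j \<or> i = k then ?l else 1 else 1)"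
  proof (rule prod.cong[OF refl])
    fix t assume "t \<in> index_pairs n"
    moreover obtain b c where t: "t = (b, c)" by (cases t)
    ultimately have bc: "(b, c) \<in> index_pairs n" by simp
    show "(case t of (b, c) \<Rightarrow>
        lam (b, b, c) powi exponent_jjk b c ?p * lam (c, b, c) powi exponent_kjk b c ?p) =
      (if t = (j, k) then if i = j \<or> i = k then ?l else 1 else 1)"
      unfolding t prod.case e'[OF bc]
      using ijk(4) by (cases "(b, c) = (j, k)"; cases "i = j"; cases "i = k") auto
  qed
  also have "\<dots> = (if i = j \<or> i = k then ?l else 1)"
    using ijk by simp
  finally have 2: "(\<Prod>(b, c)\<in>index_pairs n.
      lam (b, b, c) powi exponent_jjk b c ?p * lam (c, b, c) powi exponent_kjk b c ?p) = \<dots>" .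
  have "param_cocycle n lam ?p = (if (i, j, k) \<in> strict_triples n then ?l else 1) *
      (if (j, i, k) \<in> strict_triples n then ?l else 1) * (if i = j \<or> i = k then ?l else 1)"
    unfolding param_cocycle_eq
    by (simp only: 1 2 restrict_apply' SigmaI axis_elem_closed central_elem_closed)
  also have "\<dots> = ?l"
    using ijk by (cases i j rule: linorder_cases; cases i k rule: linorder_cases)
      (simp_all add: strict_triples_def)
  finally show ?thesis .
qed

text \<open>The only summand that could survive is \<open>fst s c * snd r (a, b)\<close> with
  \<open>b < c\<close>, at \<open>c = i\<close> and \<open>(a, b) = (j, k)\<close>; it would force
  \<open>k < i\<close>, against \<open>i \<le> k\<close>.\<close>

lemma param_cocycle_central_axis:
  assumes "(i, j, k) \<in> param_index n"
  shows "param_cocycle n lam (central_elem n (j, k) 1, axis_elem n i 1) = 1"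
proof -
  have ijk: "1 \<le> i" "i \<le> k" "1 \<le> j" "j < k" "k \<le> n"
    using assms by (auto simp: param_index_def)
  have "(\<Prod>(a, b, c)\<in>strict_triples n.
      lam (a, b, c) powi exponent_ijk a b c (central_elem n (j, k) 1, axis_elem n i 1) *
      lam (b, a, c) powi exponent_jik a b c (central_elem n (j, k) 1, axis_elem n i 1)) = 1"
    by (rule prod.neutral)
       (use ijk in \<open>auto simp: exponent_defs strict_triples_def axis_elem_def central_elem_def\<close>)
  moreover have "(\<Prod>(b, c)\<in>index_pairs n.
      lam (b, b, c) powi exponent_jjk b c (central_elem n (j, k) 1, axis_elem n i 1) *
      lam (c, b, c) powi exponent_kjk b c (central_elem n (j, k) 1, axis_elem n i 1)) = 1"
    by (rule prod.neutral)
       (use ijk in \<open>auto simp: exponent_defs axis_elem_def central_elem_def\<close>)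
  ultimately show ?thesis
    by (simp add: param_cocycle_eq)
qed

section \<open>The isomorphism\<close>

text \<open>With \<open>cnj\<close> as inverse on the circle, this is the scalar commutator, in the
  central extension, of lifts of a generator and a central basis element.\<close>

definition commutator_pairing :: "nat \<Rightarrow> (tup \<times> tup \<Rightarrow> complex) \<Rightarrow> nat \<times> nat \<times> nat \<Rightarrow> complex" where
  "commutator_pairing n \<sigma> = (\<lambda>(i, j, k)\<in>param_index n.
     \<sigma> (axis_elem n i 1, central_elem n (j, k) 1) *
     cnj (\<sigma> (central_elem n (j, k) 1, axis_elem n i 1)))"

lemma commutator_pairing_closed:
  assumes "\<sigma> \<in> two_cocycles (free_nil2 n)"
  shows "commutator_pairing n \<sigma> \<in> carrier (torus_group (param_index n))"
  by (auto simp: commutator_pairing_def norm_mult two_cocycles_norm[OF assms])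

lemma commutator_pairing_mult:
  "commutator_pairing n (cocycle_mult (free_nil2 n) \<sigma> \<tau>) =
    commutator_pairing n \<sigma> \<otimes>\<^bsub>torus_group (param_index n)\<^esub> commutator_pairing n \<tau>"
  by (auto simp: commutator_pairing_def cocycle_mult_def fun_eq_iff restrict_def)

text \<open>A coboundary is symmetric on commuting pairs, and \<open>central_elem n (j, k) 1\<close>
  is central.\<close>

lemma commutator_pairing_similar:
  assumes "(\<sigma>, \<tau>) \<in> similarity (free_nil2 n)"
  shows "commutator_pairing n \<tau> = commutator_pairing n \<sigma>"
proof -
  obtain \<beta> where \<beta>: "\<beta> \<in> carrier (free_nil2 n) \<rightarrow> circle"
    "\<And>r s. \<lbrakk>r \<in> carrier (free_nil2 n); s \<in> carrier (free_nil2 n)\<rbrakk> \<Longrightarrow>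
       \<tau> (r, s) = \<beta> r * \<beta> s * cnj (\<beta> (r \<otimes>\<^bsub>free_nil2 n\<^esub> s)) * \<sigma> (r, s)"
    using assms by (auto simp: similarity_def)
  interpret group "free_nil2 n" by (rule group_free_nil2)
  have "\<tau> (r, s) * cnj (\<tau> (s, r)) = \<sigma> (r, s) * cnj (\<sigma> (s, r))"
    if rs: "r \<in> carrier (free_nil2 n)" "s \<in> carrier (free_nil2 n)"
      "s \<otimes>\<^bsub>free_nil2 n\<^esub> r = r \<otimes>\<^bsub>free_nil2 n\<^esub> s" for r s
  proof -
    let ?c = "\<lambda>r. \<beta> r * cnj (\<beta> r)"
    have "?c r = 1" "?c s = 1" "?c (r \<otimes>\<^bsub>free_nil2 n\<^esub> s) = 1"
      using \<beta>(1) rs by (auto intro!: norm_one_mult_cnj)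
    then have "?c r * ?c s * ?c (r \<otimes>\<^bsub>free_nil2 n\<^esub> s) * (\<sigma> (r, s) * cnj (\<sigma> (s, r))) =
        \<sigma> (r, s) * cnj (\<sigma> (s, r))"
      by simp
    then show ?thesis
      using rs by (simp add: \<beta>(2) mult_ac)
  qed
  then show ?thesis
    by (auto simp: commutator_pairing_def fun_eq_iff restrict_def central_elem_commutes)
qed

lemma commutator_pairing_param_cocycle:
  assumes "lam \<in> carrier (torus_group (param_index n))"
  shows "commutator_pairing n (param_cocycle n lam) = lam"
  using assms
  by (auto simp: commutator_pairing_def fun_eq_iff restrict_def PiE_iff extensional_def
      param_cocycle_axis_central param_cocycle_central_axis)

lemma commutator_pairing_one_imp_trivial:
  assumes "\<sigma> \<in> two_cocycles (free_nil2 n)"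
    and "commutator_pairing n \<sigma> = \<one>\<^bsub>torus_group (param_index n)\<^esub>"
  shows "(\<sigma>, \<lambda>p\<in>carrier (free_nil2 n) \<times> carrier (free_nil2 n). 1) \<in> similarity (free_nil2 n)"
proof (rule trivial_if_commuting[OF assms(1)])
  fix i j k assume ijk: "(i, j, k) \<in> param_index n"
  let ?a = "\<sigma> (axis_elem n i 1, central_elem n (j, k) 1)"
  let ?b = "\<sigma> (central_elem n (j, k) 1, axis_elem n i 1)"
  have "?b * cnj ?b = 1"
    by (intro norm_one_mult_cnj two_cocycles_norm[OF assms(1)]) simp_all
  then have "?a = ?a * cnj ?b * ?b"
    by (simp add: mult_ac)
  also have "?a * cnj ?b = 1"
    using fun_cong[OF assms(2), of "(i, j, k)"] ijk by (simp add: commutator_pairing_def)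
  finally show "?a = ?b" by simp
qed

text \<open>The choice of representative is harmless by
  \<open>commutator_pairing_similar\<close>.\<close>

definition pairing_iso ::
    "nat \<Rightarrow> (tup \<times> tup \<Rightarrow> complex) set \<Rightarrow> nat \<times> nat \<times> nat \<Rightarrow> complex" where
  "pairing_iso n X = commutator_pairing n (SOME \<sigma>. \<sigma> \<in> X)"

lemma pairing_iso_class:
  assumes "\<sigma> \<in> two_cocycles (free_nil2 n)"
  shows "pairing_iso n (similarity_class (free_nil2 n) \<sigma>) = commutator_pairing n \<sigma>"
proof -
  have "\<sigma> \<in> similarity_class (free_nil2 n) \<sigma>"
    using equiv_class_self[OF equiv_similarity[OF group_free_nil2] assms]
    by (simp add: similarity_class_def)
  then have "(SOME \<tau>. \<tau> \<in> similarity_class (free_nil2 n) \<sigma>) \<in> similarity_class (free_nil2 n) \<sigma>"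
    unfolding some_in_eq by blast
  then show ?thesis
    unfolding pairing_iso_def similarity_class_def
    by (intro commutator_pairing_similar) simp
qed

lemma pairing_iso_iso: "pairing_iso n \<in> iso (H2 (free_nil2 n)) (torus_group (param_index n))"
proof -
  let ?G = "free_nil2 n" and ?T = "torus_group (param_index n)"
  note G = group_free_nil2
  interpret circle: comm_group circle_group by (rule comm_group_circle_group)
  interpret T: group ?T by (simp add: circle.is_group)
  interpret H2: comm_group "H2 ?G" by (rule comm_group_H2[OF G])
  have "pairing_iso n \<in> hom (H2 ?G) ?T"
  proof (rule homI)
    fix X assume "X \<in> carrier (H2 ?G)"
    then show "pairing_iso n X \<in> carrier ?T"
      unfolding H2_carrier using pairing_iso_class commutator_pairing_closed by fastforce
  next
    fix X Y assume "X \<in> carrier (H2 ?G)" "Y \<in> carrier (H2 ?G)"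
    then obtain \<sigma> \<tau> where \<sigma>\<tau>: "\<sigma> \<in> two_cocycles ?G" "\<tau> \<in> two_cocycles ?G"
      "X = similarity_class ?G \<sigma>" "Y = similarity_class ?G \<tau>"
      unfolding H2_carrier by blast
    then show "pairing_iso n (X \<otimes>\<^bsub>H2 ?G\<^esub> Y) = pairing_iso n X \<otimes>\<^bsub>?T\<^esub> pairing_iso n Y"
      by (simp only: H2_mult_class[OF G] pairing_iso_class cocycle_mult_closed[OF G]
          commutator_pairing_mult)
  qed
  then interpret group_hom "H2 ?G" ?T "pairing_iso n"
    by unfold_locales
  \<comment> \<open>It remains to show surjectivity, with the parametrised cocycles as preimages,
    and triviality of the kernel, by splitting the extension.\<close>
  show ?thesis
    unfolding iso_iff
  proof (intro conjI subsetI ballI impI)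
    fix lam assume lam: "lam \<in> carrier ?T"
    then have "param_cocycle n lam \<in> two_cocycles ?G"
      by (intro param_cocycle_two_cocycles) (auto simp: PiE_iff)
    then show "lam \<in> pairing_iso n ` carrier (H2 ?G)"
      using lam pairing_iso_class commutator_pairing_param_cocycle unfolding H2_carrier
      by (intro image_eqI[of _ _ "similarity_class ?G (param_cocycle n lam)"]) auto
  next
    fix X assume "X \<in> carrier (H2 ?G)" and one: "pairing_iso n X = \<one>\<^bsub>?T\<^esub>"
    then obtain \<sigma> where \<sigma>: "\<sigma> \<in> two_cocycles ?G" "X = similarity_class ?G \<sigma>"
      unfolding H2_carrier by blast
    then have "(\<sigma>, \<lambda>p\<in>carrier ?G \<times> carrier ?G. 1) \<in> similarity ?G"
      using one pairing_iso_class by (intro commutator_pairing_one_imp_trivial) auto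
    then have "similarity_class ?G \<sigma> = similarity_class ?G (\<lambda>p\<in>carrier ?G \<times> carrier ?G. 1)"
      unfolding similarity_class_def by (rule equiv_class_eq[OF equiv_similarity[OF G]])
    then show "X = \<one>\<^bsub>H2 ?G\<^esub>"
      using \<sigma> by (simp add: H2_def)
  qed
qed

section \<open>Counting and renumbering the parameters\<close>

text \<open>Raising \<open>n\<close> by one adds the triples with \<open>k = Suc n\<close>, with
  \<open>Suc n\<close> choices of \<open>i\<close> and \<open>n\<close> of \<open>j\<close>. The
  factor \<open>3\<close> on the left avoids division.\<close>

lemma card_param_index: "3 * card (param_index n) = (n + 1) * n * (n - 1)"
proof (induction n)
  case 0
  have "param_index 0 = {}" by (auto simp: param_index_def)
  then show ?case by simp
next
  case (Suc n)
  let ?A = "(\<lambda>(i, j). (i, j, Suc n)) ` ({1..Suc n} \<times> {1..n})"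
  have eq: "param_index (Suc n) = param_index n \<union> ?A"
    by (auto simp: param_index_def le_Suc_eq image_iff)
  have fin: "finite (param_index n)"
    by (rule finite_subset[of _ "{1..n} \<times> {1..n} \<times> {1..n}"]) (auto simp: param_index_def)
  have "card ?A = card ({1..Suc n} \<times> {1..n})"
    by (rule card_image) (auto simp: inj_on_def)
  moreover have "param_index n \<inter> ?A = {}"
    by (auto simp: param_index_def)
  ultimately have "card (param_index (Suc n)) = card (param_index n) + Suc n * n"
    unfolding eq using fin by (simp add: card_Un_disjoint)
  then show ?case
    using Suc by (cases n) (simp_all add: algebra_simps)
qed

text \<open>The isomorphism is precomposition with \<open>f\<close>; it carries the torus indexed by
  triples to one indexed by an initial segment of the positive integers.\<close>

lemma product_group_reindex:
  assumes f: "bij_betw f J I"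
  shows "product_group I (\<lambda>_. K) \<cong> product_group J (\<lambda>_. K)"
proof (rule is_isoI, rule isoI)
  let ?h = "\<lambda>x. \<lambda>j\<in>J. x (f j)"
  let ?g = "\<lambda>y. \<lambda>i\<in>I. y (inv_into J f i)"
  have fI: "f j \<in> I" "inv_into J f (f j) = j" if "j \<in> J" for j
    using f that by (auto simp: bij_betw_def)
  have gJ: "inv_into J f i \<in> J" "f (inv_into J f i) = i" if "i \<in> I" for i
    using f that by (auto simp: bij_betw_def inv_into_into f_inv_into_f)
  show "?h \<in> hom (product_group I (\<lambda>_. K)) (product_group J (\<lambda>_. K))"
    using fI by (intro homI) (auto simp: PiE_iff)
  show "bij_betw ?h (carrier (product_group I (\<lambda>_. K))) (carrier (product_group J (\<lambda>_. K)))"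
    by (rule bij_betw_byWitness[of _ ?g])
       (use fI gJ in \<open>auto simp: PiE_iff fun_eq_iff restrict_def extensional_def\<close>)
qed

theorem theorem2p6:
  fixes n :: nat
  assumes "n \<ge> 2"
  shows "H2 (free_nil2 n) \<cong> torus_group {1..((n + 1) * n * (n - 1)) div 3} \<and>
    card (param_index n) = ((n + 1) * n * (n - 1)) div 3 \<and>
    (\<exists>\<phi>\<in>iso (H2 (free_nil2 n)) (torus_group (param_index n)).
       \<forall>lam\<in>carrier (torus_group (param_index n)).
         param_cocycle n lam \<in> two_cocycles (free_nil2 n) \<and>
         \<phi> (similarity_class (free_nil2 n) (param_cocycle n lam)) = lam)"
proof (intro conjI bexI[OF _ pairing_iso_iso] ballI)
  show card: "card (param_index n) = ((n + 1) * n * (n - 1)) div 3"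
    using card_param_index[of n] by simp
  have "param_index n \<subseteq> {1..n} \<times> {1..n} \<times> {1..n}"
    by (auto simp: param_index_def)
  then have "finite (param_index n)"
    by (rule finite_subset) simp
  then obtain f where "bij_betw f {1..((n + 1) * n * (n - 1)) div 3} (param_index n)"
    using ex_bij_betw_nat_finite_1 card by metis
  from iso_trans[OF is_isoI[OF pairing_iso_iso] product_group_reindex[OF this]]
  show "H2 (free_nil2 n) \<cong> torus_group {1..((n + 1) * n * (n - 1)) div 3}" .
next
  fix lam assume lam: "lam \<in> carrier (torus_group (param_index n))"
  then show *: "param_cocycle n lam \<in> two_cocycles (free_nil2 n)"
    by (intro param_cocycle_two_cocycles) (auto simp: PiE_iff)
  show "pairing_iso n (similarity_class (free_nil2 n) (param_cocycle n lam)) = lam"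
    using pairing_iso_class[OF *] commutator_pairing_param_cocycle[OF lam] by simp
qed

end
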